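(* Let $\mathsf{X}$ be a category with a topological functor $|\text{-}|\colon\mathsf{X}\to\mathsf{Set}$, and let $\mathbf{1}=L\{*\}$, where $L\colon\mathsf{Set}\to\mathsf{X}$ is the left adjoint of $|\text{-}|$. Assume: (a) $\mathsf{X}$ is pre-order enriched; (b) for all objects $X,Y$ of $\mathsf{X}$, all morphisms $x,x'\colon\mathbf{1}\to X$ and every $|\text{-}|$-initial morphism $f\colon X\to Y$, if $f\cdot x\simeq f\cdot x'$ then $x\simeq x'$; (c) $\mathsf{X}$ has enough injectives: for each object $X$ of $\mathsf{X}$ there is a $|\text{-}|$-initial morphism $y_X\colon X\to\hat X$ with $\hat X$ injective, and if $X$ is separated then so is $\hat X$; (d) every injective object of $\mathsf{X}$ is exponentiable in $\mathsf{X}$; (e) the reflector from $\mathsf{X}$ to its full (reflective) subcategory $\mathsf{X}_{\mathrm{sep}}$ of separated objects preserves finite products. Then the category $\mathsf{X}\text{-}\mathsf{PEqu}_{\mathrm{sep}}$ is cartesian closed.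
   Context: A functor $|\text{-}|\colon\mathsf{X}\to\mathsf{Set}$ is topological if every (possibly large) $|\text{-}|$-structured source $(A\to|X_i|)_i$ has a unique $|\text{-}|$-initial lifting (in particular it is faithful). A morphism $f\colon X\to Y$ is $|\text{-}|$-initial if for every object $Z$ and every map $h\colon|Z|\to|X|$ such that $|f|\cdot h=|k|$ for some $k\colon Z\to Y$ in $\mathsf{X}$, there is $\bar h\colon Z\to X$ in $\mathsf{X}$ with $|\bar h|=h$. Pre-order enriched: each hom-set $\mathsf{X}(X,Y)$ carries a pre-order $\le$ and composition is monotone; $f\simeq g$ means $f\le g$ and $g\le f$. An object $X$ is separated if for all $f,g\colon Y\to X$, $f\simeq g$ implies $f=g$. The full subcategory $\mathsf{X}_{\mathrm{sep}}$ of separated objects is closed under mono-sources, hence (regular epi-)reflective in $\mathsf{X}$. An object $Z$ is injective (in the pseudo sense) if for each $|\text{-}|$-initial $y\colon X\to Y$ and each $f\colon X\to Z$ there is $\hat f\colon Y\to Z$ with $\hat f\cdot y\simeq f$. An object $X$ is exponentiable if $(-)\times X\colon\mathsf{X}\to\mathsf{X}$ has a right adjoint. $\mathsf{X}\text{-}\mathsf{PEqu}_{\mathrm{sep}}$: objects are pairs $\langle X,\equiv_{|X|}\rangle$ with $X$ a separated injective object of $\mathsf{X}$ and $\equiv_{|X|}$ a partial equivalence relation (symmetric and transitive, not necessarily reflexive) on $|X|$. A morphism $\langle X,\equiv_{|X|}\rangle\to\langle Y,\equiv_{|Y|}\rangle$ is an equivalence class $[f]$ of $\mathsf{X}$-morphisms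 $f\colon X\to Y$ with $|f|$ equivariant ($x\equiv_{|X|}x'$ implies $|f|(x)\equiv_{|Y|}|f|(x')$), where $f,g$ are equivalent iff for all $x,x'\in|X|$, $x\equiv_{|X|}x'$ implies $|f|(x)\equiv_{|Y|}|g|(x')$; composition and identities are induced from $\mathsf{X}$. *)

theory Defs
  imports "HOL-Library.FuncSet"
begin

section \<open>Categories, functors, adjunctions\<close>

record ('o, 'm) category =
  Obj :: "'o set"
  Arr :: "'m set"
  Dom :: "'m \<Rightarrow> 'o"
  Cod :: "'m \<Rightarrow> 'o"
  Ide :: "'o \<Rightarrow> 'm"
  Comp :: "'m \<Rightarrow> 'm \<Rightarrow> 'm"  (infixl \<open>\<cdot>\<index>\<close> 70)

definition hom :: "('o, 'm) category \<Rightarrow> 'o \<Rightarrow> 'o \<Rightarrow> 'm set"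
  where "hom C A B = {f \<in> Arr C. Dom C f = A \<and> Cod C f = B}"

locale category =
  fixes C :: "('o, 'm) category" (structure)
  assumes Dom_in_Obj: "f \<in> Arr C \<Longrightarrow> Dom C f \<in> Obj C"
    and Cod_in_Obj: "f \<in> Arr C \<Longrightarrow> Cod C f \<in> Obj C"
    and Ide_in_hom: "A \<in> Obj C \<Longrightarrow> Ide C A \<in> hom C A A"
    and Comp_in_hom: "\<lbrakk>f \<in> hom C A B; g \<in> hom C B D\<rbrakk> \<Longrightarrow> g \<cdot> f \<in> hom C A D"
    and Comp_Ide: "f \<in> hom C A B \<Longrightarrow> f \<cdot> Ide C A = f"
    and Ide_Comp: "f \<in> hom C A B \<Longrightarrow> Ide C B \<cdot> f = f"
    and Comp_assoc:
      "\<lbrakk>f \<in> hom C A B; g \<in> hom C B D; h \<in> hom C D E\<rbrakk> \<Longrightarrow> (h \<cdot> g) \<cdot> f = h \<cdot> (g \<cdot> f)"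

record ('o, 'm, 'p, 'n) functor_data =
  omap :: "'o \<Rightarrow> 'p"
  amap :: "'m \<Rightarrow> 'n"

definition is_functor ::
    "('o, 'm) category \<Rightarrow> ('p, 'n) category \<Rightarrow> ('o, 'm, 'p, 'n) functor_data \<Rightarrow> bool"
  where "is_functor C D F \<longleftrightarrow>
    (\<forall>A\<in>Obj C. omap F A \<in> Obj D) \<and>
    (\<forall>A\<in>Obj C. \<forall>B\<in>Obj C. \<forall>f\<in>hom C A B. amap F f \<in> hom D (omap F A) (omap F B)) \<and>
    (\<forall>A\<in>Obj C. amap F (Ide C A) = Ide D (omap F A)) \<and>
    (\<forall>A\<in>Obj C. \<forall>B\<in>Obj C. \<forall>B'\<in>Obj C. \<forall>f\<in>hom C A B. \<forall>g\<in>hom C B B'.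
      amap F (g \<cdot>\<^bsub>C\<^esub> f) = amap F g \<cdot>\<^bsub>D\<^esub> amap F f)"

definition full_subcategory :: "('o, 'm) category \<Rightarrow> 'o set \<Rightarrow> ('o, 'm) category"
  where "full_subcategory C S =
    C\<lparr>Obj := Obj C \<inter> S, Arr := {f \<in> Arr C. Dom C f \<in> S \<and> Cod C f \<in> S}\<rparr>"

definition inclusion :: "('o, 'm, 'o, 'm) functor_data"
  where "inclusion = \<lparr>omap = (\<lambda>A. A), amap = (\<lambda>f. f)\<rparr>"

text \<open>\<open>left_adjoint C D L R\<close>: the functor \<open>L\<close> from \<open>C\<close> to \<open>D\<close> is left adjoint to \<open>R\<close>;
  the adjunction is given by its unit \<open>\<eta>\<close>.\<close>

definition left_adjoint ::
    "('o, 'm) category \<Rightarrow> ('p, 'n) category \<Rightarrow>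
     ('o, 'm, 'p, 'n) functor_data \<Rightarrow> ('p, 'n, 'o, 'm) functor_data \<Rightarrow> bool"
  where "left_adjoint C D L R \<longleftrightarrow>
    is_functor C D L \<and> is_functor D C R \<and>
    (\<exists>\<eta>. (\<forall>A\<in>Obj C. \<eta> A \<in> hom C A (omap R (omap L A))) \<and>
         (\<forall>A\<in>Obj C. \<forall>B\<in>Obj C. \<forall>f\<in>hom C A B. \<eta> B \<cdot>\<^bsub>C\<^esub> f = amap R (amap L f) \<cdot>\<^bsub>C\<^esub> \<eta> A) \<and>
         (\<forall>A\<in>Obj C. \<forall>Y\<in>Obj D. \<forall>f\<in>hom C A (omap R Y).
            \<exists>!g. g \<in> hom D (omap L A) Y \<and> amap R g \<cdot>\<^bsub>C\<^esub> \<eta> A = f))"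


section \<open>Finite products and exponentials\<close>

definition is_terminal :: "('o, 'm) category \<Rightarrow> 'o \<Rightarrow> bool"
  where "is_terminal C T \<longleftrightarrow> T \<in> Obj C \<and> (\<forall>A\<in>Obj C. \<exists>!f. f \<in> hom C A T)"

definition is_product ::
    "('o, 'm) category \<Rightarrow> 'o \<Rightarrow> 'o \<Rightarrow> 'o \<Rightarrow> 'm \<Rightarrow> 'm \<Rightarrow> bool"
  where "is_product C A B P p q \<longleftrightarrow>
    P \<in> Obj C \<and> p \<in> hom C P A \<and> q \<in> hom C P B \<and>
    (\<forall>Z\<in>Obj C. \<forall>f\<in>hom C Z A. \<forall>g\<in>hom C Z B.
      \<exists>!h. h \<in> hom C Z P \<and> p \<cdot>\<^bsub>C\<^esub> h = f \<and> q \<cdot>\<^bsub>C\<^esub> h = g)"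

definition has_finite_products :: "('o, 'm) category \<Rightarrow> bool"
  where "has_finite_products C \<longleftrightarrow>
    (\<exists>T. is_terminal C T) \<and> (\<forall>A\<in>Obj C. \<forall>B\<in>Obj C. \<exists>P p q. is_product C A B P p q)"

definition preserves_finite_products ::
    "('o, 'm) category \<Rightarrow> ('p, 'n) category \<Rightarrow> ('o, 'm, 'p, 'n) functor_data \<Rightarrow> bool"
  where "preserves_finite_products C D F \<longleftrightarrow>
    (\<forall>T. is_terminal C T \<longrightarrow> is_terminal D (omap F T)) \<and>
    (\<forall>A\<in>Obj C. \<forall>B\<in>Obj C. \<forall>P p q. is_product C A B P p q \<longrightarrow>
      is_product D (omap F A) (omap F B) (omap F P) (amap F p) (amap F q))"

text \<open>\<open>T\<close> is a functor \<open>(-) \<times> X\<close>, for some choice of binary products with \<open>X\<close>.\<close>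

definition is_times_functor ::
    "('o, 'm) category \<Rightarrow> 'o \<Rightarrow> ('o, 'm, 'o, 'm) functor_data \<Rightarrow> bool"
  where "is_times_functor C X T \<longleftrightarrow>
    is_functor C C T \<and>
    (\<exists>p q. (\<forall>A\<in>Obj C. is_product C A X (omap T A) (p A) (q A)) \<and>
           (\<forall>A\<in>Obj C. \<forall>B\<in>Obj C. \<forall>f\<in>hom C A B.
              p B \<cdot>\<^bsub>C\<^esub> amap T f = f \<cdot>\<^bsub>C\<^esub> p A \<and> q B \<cdot>\<^bsub>C\<^esub> amap T f = q A))"

definition exponentiable :: "('o, 'm) category \<Rightarrow> 'o \<Rightarrow> bool"
  where "exponentiable C X \<longleftrightarrow>
    X \<in> Obj C \<and> (\<exists>T R. is_times_functor C X T \<and> left_adjoint C C T R)"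

definition cartesian_closed :: "('o, 'm) category \<Rightarrow> bool"
  where "cartesian_closed C \<longleftrightarrow>
    category C \<and> has_finite_products C \<and> (\<forall>X\<in>Obj C. exponentiable C X)"


section \<open>The category of sets\<close>

text \<open>
  Sets are the members of a universe of subsets of a type \<open>'u\<close>, with the closure properties of a
  Grothendieck universe. Since \<open>'u\<close> only provides points, a power set is represented by a
  set of codes for the subsets. Arbitrary sets of objects or arrows, which need not be members of
  the universe, play the role of classes.
\<close>

locale set_universe =
  fixes small :: "'u set \<Rightarrow> bool"
  assumes small_pair: "small {a, b}"
    and small_subset: "\<lbrakk>small A; B \<subseteq> A\<rbrakk> \<Longrightarrow> small B"
    and small_image: "small A \<Longrightarrow> small (f ` A)"
    and small_Union: "\<lbrakk>small I; \<And>i. i \<in> I \<Longrightarrow> small (F i)\<rbrakk> \<Longrightarrow> small (\<Union>i\<in>I. F i)"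
    and small_Pow: "small A \<Longrightarrow> \<exists>P code. small P \<and> bij_betw code (Pow A) P"

text \<open>No axiom of infinity is imposed, so the hereditarily finite sets also give a universe.\<close>

lemma set_universe_finite: "set_universe (finite :: nat set \<Rightarrow> bool)"
proof
  fix A :: "nat set"
  assume "finite A"
  then obtain code where "bij_betw code (Pow A) {0..<card (Pow A)}"
    using ex_bij_betw_finite_nat[of "Pow A"] by auto
  then show "\<exists>P code. finite P \<and> bij_betw code (Pow A) (P :: nat set)"
    by blast
qed (auto intro: finite_subset)

datatype ('a, 'f) arrow = Arrow (src: 'a) (body: 'f) (tgt: 'a)

definition Sets :: "('u set \<Rightarrow> bool) \<Rightarrow> ('u set, ('u set, 'u \<Rightarrow> 'u) arrow) category"
  where "Sets small =
    \<lparr>Obj = {A. small A},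
     Arr = {Arrow A f B | A f B. small A \<and> small B \<and> f \<in> A \<rightarrow>\<^sub>E B},
     Dom = src,
     Cod = tgt,
     Ide = (\<lambda>A. Arrow A (\<lambda>x\<in>A. x) A),
     Comp = (\<lambda>g f. Arrow (src f) (compose (src f) (body g) (body f)) (tgt g))\<rparr>"


section \<open>Topological functors\<close>

text \<open>
  A structured source \<open>(A \<rightarrow> F X\<^sub>i)\<^sub>i\<close> is the set of its members
  \<open>(X\<^sub>i, A \<rightarrow> F X\<^sub>i)\<close>, indexed by itself; repetitions do not affect initiality.
  Here \<open>S\<close> is an arbitrary set of such pairs, so large sources are included.
\<close>

definition structured_source ::
    "('o, 'm) category \<Rightarrow> ('p, 'n) category \<Rightarrow> ('o, 'm, 'p, 'n) functor_data \<Rightarrow>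
     'p \<Rightarrow> ('o \<times> 'n) set \<Rightarrow> bool"
  where "structured_source C D F A S \<longleftrightarrow>
    A \<in> Obj D \<and> (\<forall>(X, f)\<in>S. X \<in> Obj C \<and> f \<in> hom D A (omap F X))"

definition is_initial_lift ::
    "('o, 'm) category \<Rightarrow> ('p, 'n) category \<Rightarrow> ('o, 'm, 'p, 'n) functor_data \<Rightarrow>
     'p \<Rightarrow> ('o \<times> 'n) set \<Rightarrow> 'o \<Rightarrow> ('o \<times> 'n \<Rightarrow> 'm) \<Rightarrow> bool"
  where "is_initial_lift C D F A S A' g \<longleftrightarrow>
    A' \<in> Obj C \<and> omap F A' = A \<and> g \<in> extensional S \<and>
    (\<forall>(X, f)\<in>S. g (X, f) \<in> hom C A' X \<and> amap F (g (X, f)) = f) \<and>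
    (\<forall>Z\<in>Obj C. \<forall>h\<in>hom D (omap F Z) (omap F A').
      (\<forall>(X, f)\<in>S. \<exists>k\<in>hom C Z X. amap F (g (X, f)) \<cdot>\<^bsub>D\<^esub> h = amap F k) \<longrightarrow>
      (\<exists>h'\<in>hom C Z A'. amap F h' = h))"

definition topological ::
    "('o, 'm) category \<Rightarrow> ('p, 'n) category \<Rightarrow> ('o, 'm, 'p, 'n) functor_data \<Rightarrow> bool"
  where "topological C D F \<longleftrightarrow>
    is_functor C D F \<and>
    (\<forall>A S. structured_source C D F A S \<longrightarrow>
      (\<exists>!(A', g). is_initial_lift C D F A S A' g))"

definition initial_morphism ::
    "('o, 'm) category \<Rightarrow> ('p, 'n) category \<Rightarrow> ('o, 'm, 'p, 'n) functor_data \<Rightarrow>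
     'o \<Rightarrow> 'o \<Rightarrow> 'm \<Rightarrow> bool"
  where "initial_morphism C D F X Y f \<longleftrightarrow>
    X \<in> Obj C \<and> Y \<in> Obj C \<and> f \<in> hom C X Y \<and>
    (\<forall>Z\<in>Obj C. \<forall>h\<in>hom D (omap F Z) (omap F X).
      (\<exists>k\<in>hom C Z Y. amap F f \<cdot>\<^bsub>D\<^esub> h = amap F k) \<longrightarrow>
      (\<exists>h'\<in>hom C Z X. amap F h' = h))"


section \<open>Pre-order enriched categories, separated and injective objects\<close>

text \<open>The pre-orders on all hom-sets are given by one relation \<open>le\<close> on arrows, of which only the
  restrictions to hom-sets matter.\<close>

definition preorder_enriched :: "('o, 'm) category \<Rightarrow> ('m \<Rightarrow> 'm \<Rightarrow> bool) \<Rightarrow> bool"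
  where "preorder_enriched C le \<longleftrightarrow>
    (\<forall>X\<in>Obj C. \<forall>Y\<in>Obj C. reflp_on (hom C X Y) le \<and> transp_on (hom C X Y) le) \<and>
    (\<forall>X\<in>Obj C. \<forall>Y\<in>Obj C. \<forall>Z\<in>Obj C.
      \<forall>f\<in>hom C X Y. \<forall>f'\<in>hom C X Y. \<forall>g\<in>hom C Y Z. \<forall>g'\<in>hom C Y Z.
        le f f' \<and> le g g' \<longrightarrow> le (g \<cdot>\<^bsub>C\<^esub> f) (g' \<cdot>\<^bsub>C\<^esub> f'))"

definition simeq :: "('m \<Rightarrow> 'm \<Rightarrow> bool) \<Rightarrow> 'm \<Rightarrow> 'm \<Rightarrow> bool"
  where "simeq le f g \<longleftrightarrow> le f g \<and> le g f"

definition separated :: "('o, 'm) category \<Rightarrow> ('m \<Rightarrow> 'm \<Rightarrow> bool) \<Rightarrow> 'o \<Rightarrow> bool"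
  where "separated C le X \<longleftrightarrow>
    X \<in> Obj C \<and> (\<forall>Y\<in>Obj C. \<forall>f\<in>hom C Y X. \<forall>g\<in>hom C Y X. simeq le f g \<longrightarrow> f = g)"

definition injective_object ::
    "('o, 'm) category \<Rightarrow> ('p, 'n) category \<Rightarrow> ('o, 'm, 'p, 'n) functor_data \<Rightarrow>
     ('m \<Rightarrow> 'm \<Rightarrow> bool) \<Rightarrow> 'o \<Rightarrow> bool"
  where "injective_object C D F le Z \<longleftrightarrow>
    Z \<in> Obj C \<and>
    (\<forall>X Y y. initial_morphism C D F X Y y \<longrightarrow>
      (\<forall>f\<in>hom C X Z. \<exists>f'\<in>hom C Y Z. simeq le (f' \<cdot>\<^bsub>C\<^esub> y) f))"

definition enough_injectives ::
    "('o, 'm) category \<Rightarrow> ('p, 'n) category \<Rightarrow> ('o, 'm, 'p, 'n) functor_data \<Rightarrow>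
     ('m \<Rightarrow> 'm \<Rightarrow> bool) \<Rightarrow> bool"
  where "enough_injectives C D F le \<longleftrightarrow>
    (\<forall>X\<in>Obj C. \<exists>X' y. initial_morphism C D F X X' y \<and> injective_object C D F le X' \<and>
      (separated C le X \<longrightarrow> separated C le X'))"

definition separated_subcategory ::
    "('o, 'm) category \<Rightarrow> ('m \<Rightarrow> 'm \<Rightarrow> bool) \<Rightarrow> ('o, 'm) category"
  where "separated_subcategory C le = full_subcategory C {X. separated C le X}"

definition is_separated_reflector ::
    "('o, 'm) category \<Rightarrow> ('m \<Rightarrow> 'm \<Rightarrow> bool) \<Rightarrow> ('o, 'm, 'o, 'm) functor_data \<Rightarrow> bool"
  where "is_separated_reflector C le R \<longleftrightarrow>
    left_adjoint C (separated_subcategory C le) R inclusion"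


section \<open>The category of partial equivalence relations on separated injective objects\<close>

text \<open>In what follows \<open>U\<close> is the functor to sets, so \<open>body (amap U f)\<close> is the underlying
  function of \<open>f\<close>.\<close>

type_synonym ('o, 'u) per_object = "'o \<times> ('u \<times> 'u) set"

type_synonym ('o, 'm, 'u) set_functor =
  "('o, 'm, 'u set, ('u set, 'u \<Rightarrow> 'u) arrow) functor_data"

definition PEqu_objects ::
    "('u set \<Rightarrow> bool) \<Rightarrow> ('o, 'm) category \<Rightarrow> ('o, 'm, 'u) set_functor \<Rightarrow>
     ('m \<Rightarrow> 'm \<Rightarrow> bool) \<Rightarrow> ('o, 'u) per_object set"
  where "PEqu_objects small C U le =
    {(X, E). separated C le X \<and> injective_object C (Sets small) U le X \<and>
             E \<subseteq> omap U X \<times> omap U X \<and> sym E \<and> trans E}"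

definition equivariant ::
    "('o, 'm) category \<Rightarrow> ('o, 'm, 'u) set_functor \<Rightarrow>
     ('o, 'u) per_object \<Rightarrow> ('o, 'u) per_object \<Rightarrow> 'm set"
  where "equivariant C U P Q =
    {f \<in> hom C (fst P) (fst Q).
      \<forall>(x, x')\<in>snd P. (body (amap U f) x, body (amap U f) x') \<in> snd Q}"

definition PEqu_rel ::
    "('o, 'm) category \<Rightarrow> ('o, 'm, 'u) set_functor \<Rightarrow>
     ('o, 'u) per_object \<Rightarrow> ('o, 'u) per_object \<Rightarrow> ('m \<times> 'm) set"
  where "PEqu_rel C U P Q =
    {(f, g). f \<in> equivariant C U P Q \<and> g \<in> equivariant C U P Q \<and>
      (\<forall>(x, x')\<in>snd P. (body (amap U f) x, body (amap U g) x') \<in> snd Q)}"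

text \<open>The composite of \<open>[g]\<close> and \<open>[f]\<close> is the union of the classes of the composites of all
  representatives; as composition respects the equivalence, all these classes coincide.\<close>

definition PEqu_sep ::
    "('u set \<Rightarrow> bool) \<Rightarrow> ('o, 'm) category \<Rightarrow> ('o, 'm, 'u) set_functor \<Rightarrow>
     ('m \<Rightarrow> 'm \<Rightarrow> bool) \<Rightarrow>
     (('o, 'u) per_object, (('o, 'u) per_object, 'm set) arrow) category"
  where "PEqu_sep small C U le =
    \<lparr>Obj = PEqu_objects small C U le,
     Arr = {Arrow P c Q | P c Q. P \<in> PEqu_objects small C U le \<and> Q \<in> PEqu_objects small C U le \<and>
              c \<in> equivariant C U P Q // PEqu_rel C U P Q},
     Dom = src,
     Cod = tgt,
     Ide = (\<lambda>P. Arrow P (PEqu_rel C U P P `` {Ide C (fst P)}) P),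
     Comp = (\<lambda>G F. Arrow (src F)
              (\<Union>g\<in>body G. \<Union>f\<in>body F. PEqu_rel C U (src F) (tgt G) `` {g \<cdot>\<^bsub>C\<^esub> f}) (tgt G))\<rparr>"

end

theory Submission
  imports Defs
begin

text \<open>
  A function space of partial equivalence relations needs only a function space of the carriers: if
  \<open>Y\<^sup>A\<close> is an exponential in \<open>X\<close>, then relating two of its points when they send related arguments to
  related values gives an exponential of partial equivalence relations on \<open>A\<close> and \<open>Y\<close>
  (\<open>ex_exponential_PE\<close>). Likewise, products and the terminal object are those of \<open>X\<close> with the evident
  relations (\<open>pprd_product\<close>, \<open>ex_terminal_PE\<close>). It therefore has to be shown that the separated
  injective objects of \<open>X\<close> are closed under these constructions. Being injective, all
  of them are exponentiable in \<open>X\<close>.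

  For products this is direct: extensions along initial morphisms and equality of \<open>\<simeq>\<close>-equivalent
  morphisms are obtained componentwise (\<open>sep_prd\<close>, \<open>inj_obj_prd\<close>). The exponential \<open>Y\<^sup>A\<close> is
  injective because \<open>y \<times> A\<close> is initial whenever \<open>y\<close> is: extending a morphism into \<open>Y\<^sup>A\<close> along \<open>y\<close> means
  extending its transpose along \<open>y \<times> A\<close> (\<open>inj_obj_exponential\<close>).

  Separatedness of \<open>Y\<^sup>A\<close> is the delicate point, as transposition is not assumed to respect the order.
  It is the classical fact that a reflective subcategory whose reflector \<open>R\<close> preserves finite
  products is closed under exponentials: the evaluation factors through \<open>R (Y\<^sup>A \<times> A)\<close>, and
  \<open>R Y\<^sup>A \<times> A\<close> maps to this object, so that the transpose of the composite is a retraction of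
  \<open>Y\<^sup>A \<rightarrow> R Y\<^sup>A\<close>; a retract of a separated object is separated (\<open>sep_exponential\<close>). The reflector
  itself is constructed from initial lifts: points of an object are identified when no morphism
  into a separated object distinguishes them (\<open>ex_separated_reflection\<close>).

  Since a topological functor is faithful (\<open>faithful\<close>), equations between morphisms of \<open>X\<close> can be
  checked on points.
\<close>

section \<open>Exponentials relative to chosen products\<close>

context category
begin

lemma hom_Obj: "f \<in> hom C A B \<Longrightarrow> A \<in> Obj C" "f \<in> hom C A B \<Longrightarrow> B \<in> Obj C"
  using Dom_in_Obj Cod_in_Obj by (auto simp: hom_def)

lemma product_pair:
  assumes "is_product C A B P p q" "f \<in> hom C Z A" "g \<in> hom C Z B"
  obtains m where "m \<in> hom C Z P" "p \<cdot> m = f" "q \<cdot> m = g"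
  using assms hom_Obj(1)[OF assms(2)] unfolding is_product_def by blast

lemma product_eqI:
  assumes "is_product C A B P p q" "m \<in> hom C Z P" "m' \<in> hom C Z P"
    and "p \<cdot> m = p \<cdot> m'" "q \<cdot> m = q \<cdot> m'"
  shows "m = m'"
proof -
  have p: "p \<in> hom C P A" "q \<in> hom C P B"
    using assms(1) unfolding is_product_def by auto
  have "p \<cdot> m' \<in> hom C Z A" "q \<cdot> m' \<in> hom C Z B" "Z \<in> Obj C"
    using Comp_in_hom p assms(3) hom_Obj by blast+
  then show ?thesis
    using assms unfolding is_product_def by metis
qed

end

text \<open>
  \<open>P Z\<close>, with projections \<open>p Z\<close> and \<open>q Z\<close>, stands for a product \<open>Z \<times> A\<close> with a fixed object \<open>A\<close>. The
  arrow \<open>m\<close> below is \<open>k \<times> A\<close>, expressed by its two projections; quantifying over it makes the universal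
  property of the evaluation independent of a functor \<open>(-) \<times> A\<close>.
\<close>

definition is_exponential ::
    "('o, 'm) category \<Rightarrow> ('o \<Rightarrow> 'o) \<Rightarrow> ('o \<Rightarrow> 'm) \<Rightarrow> ('o \<Rightarrow> 'm) \<Rightarrow> 'o \<Rightarrow> 'o \<Rightarrow> 'm \<Rightarrow> bool"
  where "is_exponential C P p q Y E ev \<longleftrightarrow>
    E \<in> Obj C \<and> ev \<in> hom C (P E) Y \<and>
    (\<forall>Z\<in>Obj C. \<forall>h\<in>hom C (P Z) Y. \<exists>!k. k \<in> hom C Z E \<and>
      (\<exists>m\<in>hom C (P Z) (P E). p E \<cdot>\<^bsub>C\<^esub> m = k \<cdot>\<^bsub>C\<^esub> p Z \<and> q E \<cdot>\<^bsub>C\<^esub> m = q Z \<and> ev \<cdot>\<^bsub>C\<^esub> m = h))"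

locale products_with = category C for C :: "('o, 'm) category" (structure) +
  fixes X :: 'o and P :: "'o \<Rightarrow> 'o" and p q :: "'o \<Rightarrow> 'm"
  assumes product: "A \<in> Obj C \<Longrightarrow> is_product C A X (P A) (p A) (q A)"
begin

lemma P_Obj: "A \<in> Obj C \<Longrightarrow> P A \<in> Obj C"
  and p_hom: "A \<in> Obj C \<Longrightarrow> p A \<in> hom C (P A) A"
  and q_hom: "A \<in> Obj C \<Longrightarrow> q A \<in> hom C (P A) X"
  using product unfolding is_product_def by auto

definition times_arr :: "'m \<Rightarrow> 'm"
  where "times_arr f = (THE m. m \<in> hom C (P (Dom C f)) (P (Cod C f)) \<and>
    p (Cod C f) \<cdot> m = f \<cdot> p (Dom C f) \<and> q (Cod C f) \<cdot> m = q (Dom C f))"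

lemma times_arr:
  assumes f: "f \<in> hom C A B"
  shows "times_arr f \<in> hom C (P A) (P B)" "p B \<cdot> times_arr f = f \<cdot> p A" "q B \<cdot> times_arr f = q A"
proof -
  have AB: "A \<in> Obj C" "B \<in> Obj C" using hom_Obj[OF f] by auto
  have "f \<cdot> p A \<in> hom C (P A) B" "P A \<in> Obj C" "q A \<in> hom C (P A) X"
    using Comp_in_hom p_hom f AB q_hom P_Obj by blast+
  then have "\<exists>!m. m \<in> hom C (P A) (P B) \<and> p B \<cdot> m = f \<cdot> p A \<and> q B \<cdot> m = q A"
    using product[OF AB(2)] unfolding is_product_def by blast
  moreover have "Dom C f = A" "Cod C f = B" using f by (auto simp: hom_def)
  ultimately have "times_arr f \<in> hom C (P A) (P B) \<and> p B \<cdot> times_arr f = f \<cdot> p A \<and> q B \<cdot> times_arr f = q A"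
    unfolding times_arr_def by (simp only:) (erule theI')
  then show "times_arr f \<in> hom C (P A) (P B)" "p B \<cdot> times_arr f = f \<cdot> p A" "q B \<cdot> times_arr f = q A" by auto
qed

lemma times_arr_unique:
  assumes "f \<in> hom C A B" "m \<in> hom C (P A) (P B)" "p B \<cdot> m = f \<cdot> p A" "q B \<cdot> m = q A"
  shows "m = times_arr f"
  using product_eqI[OF product[OF hom_Obj(2)[OF assms(1)]]] assms times_arr[OF assms(1)] by metis

lemma times_arr_Ide: "A \<in> Obj C \<Longrightarrow> times_arr (Ide C A) = Ide C (P A)"
  using times_arr_unique[OF Ide_in_hom Ide_in_hom[OF P_Obj], of A] Ide_Comp Comp_Ide p_hom q_hom
  by metis

lemma times_arr_Comp:
  assumes f: "f \<in> hom C A B" and g: "g \<in> hom C B D"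
  shows "times_arr (g \<cdot> f) = times_arr g \<cdot> times_arr f"
proof -
  have O: "A \<in> Obj C" "B \<in> Obj C" "D \<in> Obj C" using hom_Obj f g by auto
  have "p D \<cdot> (times_arr g \<cdot> times_arr f) = (p D \<cdot> times_arr g) \<cdot> times_arr f"
    using Comp_assoc[OF times_arr(1)[OF f] times_arr(1)[OF g] p_hom[OF O(3)]] by simp
  also have "\<dots> = g \<cdot> (p B \<cdot> times_arr f)"
    using Comp_assoc[OF times_arr(1)[OF f] p_hom[OF O(2)] g] times_arr[OF g] by simp
  also have "\<dots> = (g \<cdot> f) \<cdot> p A"
    using Comp_assoc[OF p_hom[OF O(1)] f g] times_arr[OF f] by simp
  finally have 1: "p D \<cdot> (times_arr g \<cdot> times_arr f) = (g \<cdot> f) \<cdot> p A" .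
  have 2: "q D \<cdot> (times_arr g \<cdot> times_arr f) = q A"
    using Comp_assoc[OF times_arr(1)[OF f] times_arr(1)[OF g] q_hom[OF O(3)]] times_arr[OF f] times_arr[OF g] by simp
  show ?thesis
    using times_arr_unique[OF Comp_in_hom[OF f g] Comp_in_hom[OF times_arr(1)[OF f] times_arr(1)[OF g]] 1 2] by simp
qed

lemma is_exponential_iff_times_arr:
  "is_exponential C P p q Y E ev \<longleftrightarrow> E \<in> Obj C \<and> ev \<in> hom C (P E) Y \<and>
    (\<forall>Z\<in>Obj C. \<forall>h\<in>hom C (P Z) Y. \<exists>!k. k \<in> hom C Z E \<and> ev \<cdot> times_arr k = h)"
proof -
  have "(k \<in> hom C Z E \<and>
      (\<exists>m\<in>hom C (P Z) (P E). p E \<cdot> m = k \<cdot> p Z \<and> q E \<cdot> m = q Z \<and> ev \<cdot> m = h)) \<longleftrightarrow>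
      (k \<in> hom C Z E \<and> ev \<cdot> times_arr k = h)" for k Z h
    using times_arr[of k Z E] times_arr_unique[of k Z E] by blast
  then show ?thesis unfolding is_exponential_def by simp
qed

lemma times_functor: "is_times_functor C X \<lparr>omap = P, amap = times_arr\<rparr>"
  unfolding is_times_functor_def is_functor_def
  using P_Obj by (intro conjI exI[of _ p] exI[of _ q]) (auto simp: times_arr times_arr_Ide times_arr_Comp product)

text \<open>
  Transposition along the evaluations defines the right adjoint on arrows and the unit; all
  equations hold because both sides have the same transpose.
\<close>

lemma exponentiableI:
  assumes X: "X \<in> Obj C" and ex: "\<And>Y. Y \<in> Obj C \<Longrightarrow> \<exists>E ev. is_exponential C P p q Y E ev"
  shows "exponentiable C X"
proof -
  obtain E ev where E: "\<And>Y. Y \<in> Obj C \<Longrightarrow> is_exponential C P p q Y (E Y) (ev Y)"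
    using ex by metis
  have EO: "E Y \<in> Obj C" and ev: "ev Y \<in> hom C (P (E Y)) Y" if "Y \<in> Obj C" for Y
    using E[OF that] by (auto simp: is_exponential_def)
  define tr where "tr Z Y h = (THE k. k \<in> hom C Z (E Y) \<and> ev Y \<cdot> times_arr k = h)" for Z Y h
  have tr: "tr Z Y h \<in> hom C Z (E Y) \<and> ev Y \<cdot> times_arr (tr Z Y h) = h"
    if "Z \<in> Obj C" "Y \<in> Obj C" "h \<in> hom C (P Z) Y" for Z Y h
    unfolding tr_def by (rule theI') (use E[OF that(2)] that in \<open>simp add: is_exponential_iff_times_arr\<close>)
  have eqI: "k = k'"
    if "k \<in> hom C Z (E Y)" "k' \<in> hom C Z (E Y)" "ev Y \<cdot> times_arr k = ev Y \<cdot> times_arr k'" "Y \<in> Obj C"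
    for k k' Z Y
  proof -
    have Z: "Z \<in> Obj C" using that(1) hom_Obj by blast
    have "ev Y \<cdot> times_arr k' \<in> hom C (P Z) Y"
      using Comp_in_hom[OF times_arr(1)[OF that(2)] ev[OF that(4)]] .
    then have "\<exists>!k. k \<in> hom C Z (E Y) \<and> ev Y \<cdot> times_arr k = ev Y \<cdot> times_arr k'"
      using E[OF that(4)] Z unfolding is_exponential_iff_times_arr by blast
    then show ?thesis using that by blast
  qed
  define rm where "rm g = tr (E (Dom C g)) (Cod C g) (g \<cdot> ev (Dom C g))" for g
  have rm: "rm g \<in> hom C (E A) (E B)" "ev B \<cdot> times_arr (rm g) = g \<cdot> ev A" if "g \<in> hom C A B" for g A B
  proof -
    have O: "A \<in> Obj C" "B \<in> Obj C" and D: "Dom C g = A" "Cod C g = B"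
      using hom_Obj that by (auto simp: hom_def)
    have "g \<cdot> ev A \<in> hom C (P (E A)) B" using Comp_in_hom[OF ev[OF O(1)] that] .
    from tr[OF EO[OF O(1)] O(2) this]
    show "rm g \<in> hom C (E A) (E B)" "ev B \<cdot> times_arr (rm g) = g \<cdot> ev A"
      unfolding rm_def D by auto
  qed
  have ev_Comp: "ev Y \<cdot> times_arr (k' \<cdot> k) = (ev Y \<cdot> times_arr k') \<cdot> times_arr k"
    if "k \<in> hom C Z W" "k' \<in> hom C W (E Y)" "Y \<in> Obj C" for k k' Z W Y
    using times_arr_Comp[OF that(1,2)] Comp_assoc[OF times_arr(1)[OF that(1)] times_arr(1)[OF that(2)] ev[OF that(3)]]
    by simp
  have rm_tr: "ev Y \<cdot> times_arr (rm g \<cdot> k) = g \<cdot> (ev A \<cdot> times_arr k)"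
    if "k \<in> hom C Z (E A)" "g \<in> hom C A Y" for g k Z A Y
    using ev_Comp[OF that(1) rm(1)[OF that(2)] hom_Obj(2)[OF that(2)]] rm(2)[OF that(2)]
      Comp_assoc[OF times_arr(1)[OF that(1)] ev[OF hom_Obj(1)[OF that(2)]] that(2)] by simp
  define R where "R = \<lparr>omap = E, amap = rm\<rparr>"
  define T where "T = \<lparr>omap = P, amap = times_arr\<rparr>"
  define \<eta> where "\<eta> A = tr A (P A) (Ide C (P A))" for A
  have \<eta>: "\<eta> A \<in> hom C A (E (P A))" "ev (P A) \<cdot> times_arr (\<eta> A) = Ide C (P A)" if "A \<in> Obj C" for A
    using tr[OF that P_Obj[OF that] Ide_in_hom[OF P_Obj[OF that]]] unfolding \<eta>_def by auto
  have "rm (Ide C A) = Ide C (E A)" if A: "A \<in> Obj C" for A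
  proof (rule eqI)
    show "ev A \<cdot> times_arr (rm (Ide C A)) = ev A \<cdot> times_arr (Ide C (E A))"
      using rm(2)[OF Ide_in_hom[OF A]] Ide_Comp[OF ev[OF A]] Comp_Ide[OF ev[OF A]]
        times_arr_Ide[OF EO[OF A]] by simp
  qed (use A Ide_in_hom EO rm in auto)
  moreover have "rm (g \<cdot> f) = rm g \<cdot> rm f" if f: "f \<in> hom C A B" and g: "g \<in> hom C B D" for A B D f g
  proof (rule eqI)
    note O = hom_Obj[OF f] hom_Obj[OF g]
    show "rm (g \<cdot> f) \<in> hom C (E A) (E D)" using rm Comp_in_hom[OF f g] by blast
    show "rm g \<cdot> rm f \<in> hom C (E A) (E D)" using rm f g Comp_in_hom by blast
    show "ev D \<cdot> times_arr (rm (g \<cdot> f)) = ev D \<cdot> times_arr (rm g \<cdot> rm f)"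
      using rm(2)[OF Comp_in_hom[OF f g]] rm_tr[OF rm(1)[OF f] g] rm(2)[OF f]
        Comp_assoc[OF ev[OF O(1)] f g] by simp
  qed (use hom_Obj g in auto)
  ultimately have R: "is_functor C C R"
    unfolding is_functor_def R_def using rm EO by auto
  have T: "is_times_functor C X T" unfolding T_def by (rule times_functor)
  have nat: "\<eta> B \<cdot> f = rm (times_arr f) \<cdot> \<eta> A" if f: "f \<in> hom C A B" for A B f
  proof (rule eqI)
    note O = hom_Obj[OF f]
    show "\<eta> B \<cdot> f \<in> hom C A (E (P B))" using Comp_in_hom[OF f \<eta>(1)[OF O(2)]] .
    show "rm (times_arr f) \<cdot> \<eta> A \<in> hom C A (E (P B))"
      using Comp_in_hom[OF \<eta>(1)[OF O(1)] rm(1)[OF times_arr(1)[OF f]]] .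
    show "ev (P B) \<cdot> times_arr (\<eta> B \<cdot> f) = ev (P B) \<cdot> times_arr (rm (times_arr f) \<cdot> \<eta> A)"
      using ev_Comp[OF f \<eta>(1)[OF O(2)] P_Obj[OF O(2)]] rm_tr[OF \<eta>(1)[OF O(1)] times_arr(1)[OF f]]
        \<eta>(2)[OF O(1)] \<eta>(2)[OF O(2)] Ide_Comp[OF times_arr(1)[OF f]] Comp_Ide[OF times_arr(1)[OF f]] by simp
  qed (use hom_Obj[OF f] P_Obj in auto)
  have univ: "\<exists>!g. g \<in> hom C (P A) Y \<and> rm g \<cdot> \<eta> A = f"
    if A: "A \<in> Obj C" and Y: "Y \<in> Obj C" and f: "f \<in> hom C A (E Y)" for A Y f
  proof -
    have tr\<eta>: "ev Y \<cdot> times_arr (rm g \<cdot> \<eta> A) = g" if "g \<in> hom C (P A) Y" for g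
      using rm_tr[OF \<eta>(1)[OF A] that] \<eta>(2)[OF A] Comp_Ide[OF that] by simp
    have g: "ev Y \<cdot> times_arr f \<in> hom C (P A) Y" using Comp_in_hom[OF times_arr(1)[OF f] ev[OF Y]] .
    show ?thesis
    proof (rule ex1I[of _ "ev Y \<cdot> times_arr f"])
      have "rm (ev Y \<cdot> times_arr f) \<cdot> \<eta> A = f"
        using eqI[OF Comp_in_hom[OF \<eta>(1)[OF A] rm(1)[OF g]] f tr\<eta>[OF g] Y] .
      then show "ev Y \<cdot> times_arr f \<in> hom C (P A) Y \<and> rm (ev Y \<cdot> times_arr f) \<cdot> \<eta> A = f" using g by simp
    qed (use tr\<eta> in auto)
  qed
  have "is_functor C C T" using T by (simp add: is_times_functor_def)
  then have "left_adjoint C C T R"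
    unfolding left_adjoint_def using R
  proof (intro conjI exI[of _ \<eta>])
    show "\<forall>A\<in>Obj C. \<eta> A \<in> hom C A (omap R (omap T A))"
      by (simp add: R_def T_def \<eta>)
    show "\<forall>A\<in>Obj C. \<forall>B\<in>Obj C. \<forall>f\<in>hom C A B. \<eta> B \<cdot> f = amap R (amap T f) \<cdot> \<eta> A"
      by (simp add: R_def T_def nat)
    show "\<forall>A\<in>Obj C. \<forall>Y\<in>Obj C. \<forall>f\<in>hom C A (omap R Y).
        \<exists>!g. g \<in> hom C (omap T A) Y \<and> amap R g \<cdot> \<eta> A = f"
      by (simp add: R_def T_def univ)
  qed
  then show ?thesis unfolding exponentiable_def using X T by blast
qed

text \<open>
  The products chosen by the functor \<open>(-) \<times> X\<close> in the definition of exponentiability may differ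
  from the given ones, so the evaluation is transported along the comparison isomorphisms.
\<close>

lemma exponentiableD:
  assumes "exponentiable C X" and Y: "Y \<in> Obj C"
  shows "\<exists>E ev. is_exponential C P p q Y E ev"
proof -
  obtain T R where T: "is_times_functor C X T" and adj: "left_adjoint C C T R"
    using assms(1) unfolding exponentiable_def by auto
  obtain p' q' where "(\<forall>A\<in>Obj C. is_product C A X (omap T A) (p' A) (q' A)) \<and>
      (\<forall>A\<in>Obj C. \<forall>B\<in>Obj C. \<forall>f\<in>hom C A B.
        p' B \<cdot> amap T f = f \<cdot> p' A \<and> q' B \<cdot> amap T f = q' A)"
    using T unfolding is_times_functor_def by (elim conjE exE) fast
  then have pq': "\<And>A. A \<in> Obj C \<Longrightarrow> is_product C A X (omap T A) (p' A) (q' A)"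
    and T_p': "\<And>A B f. f \<in> hom C A B \<Longrightarrow> p' B \<cdot> amap T f = f \<cdot> p' A \<and> q' B \<cdot> amap T f = q' A"
    using hom_Obj by simp_all
  interpret T: products_with C X "omap T" p' q'
    using pq' by unfold_locales
  have T_hom: "amap T f \<in> hom C (omap T A) (omap T B)" if "f \<in> hom C A B" for f A B
    using T that hom_Obj[OF that] unfolding is_times_functor_def is_functor_def by auto
  have amap_T: "amap T f = T.times_arr f" if "f \<in> hom C A B" for f A B
    using T.times_arr_unique[OF that T_hom[OF that]] T_p'[OF that] by auto
  have R_hom: "amap R f \<in> hom C (omap R A) (omap R B)" if "f \<in> hom C A B" for f A B
    using adj that hom_Obj[OF that] unfolding left_adjoint_def is_functor_def by auto
  have R_Obj: "omap R A \<in> Obj C" if "A \<in> Obj C" for A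
    using adj that unfolding left_adjoint_def is_functor_def by auto
  have R_Comp: "amap R (g \<cdot> f) = amap R g \<cdot> amap R f"
    if "f \<in> hom C A B" "g \<in> hom C B D" for f g A B D
    using adj that hom_Obj[OF that(1)] hom_Obj[OF that(2)]
    unfolding left_adjoint_def is_functor_def by auto
  obtain \<eta> where "(\<forall>A\<in>Obj C. \<eta> A \<in> hom C A (omap R (omap T A))) \<and>
      (\<forall>A\<in>Obj C. \<forall>B\<in>Obj C. \<forall>f\<in>hom C A B. \<eta> B \<cdot> f = amap R (amap T f) \<cdot> \<eta> A) \<and>
      (\<forall>A\<in>Obj C. \<forall>Y\<in>Obj C. \<forall>f\<in>hom C A (omap R Y).
        \<exists>!g. g \<in> hom C (omap T A) Y \<and> amap R g \<cdot> \<eta> A = f)"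
    using adj unfolding left_adjoint_def by (elim conjE exE) fast
  then have \<eta>: "\<And>A. A \<in> Obj C \<Longrightarrow> \<eta> A \<in> hom C A (omap R (omap T A))"
    and nat: "\<And>A B f. \<lbrakk>A \<in> Obj C; B \<in> Obj C; f \<in> hom C A B\<rbrakk> \<Longrightarrow>
      \<eta> B \<cdot> f = amap R (amap T f) \<cdot> \<eta> A"
    and univ: "\<And>A Y f. \<lbrakk>A \<in> Obj C; Y \<in> Obj C; f \<in> hom C A (omap R Y)\<rbrakk> \<Longrightarrow>
      \<exists>!g. g \<in> hom C (omap T A) Y \<and> amap R g \<cdot> \<eta> A = f"
    by (elim conjE; blast)+
  define E where "E = omap R Y"
  have E: "E \<in> Obj C" unfolding E_def using R_Obj Y .
  obtain \<epsilon> where \<epsilon>: "\<epsilon> \<in> hom C (omap T E) Y" "amap R \<epsilon> \<cdot> \<eta> E = Ide C E"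
    using univ[OF E Y] Ide_in_hom[OF E] unfolding E_def by blast
  have R\<epsilon>: "amap R (\<epsilon> \<cdot> T.times_arr k) \<cdot> \<eta> Z = k" if k: "k \<in> hom C Z E" for k Z
  proof -
    have Z: "Z \<in> Obj C" using hom_Obj k by blast
    have "amap R (\<epsilon> \<cdot> T.times_arr k) \<cdot> \<eta> Z = amap R \<epsilon> \<cdot> (amap R (T.times_arr k) \<cdot> \<eta> Z)"
      using R_Comp[OF T.times_arr(1)[OF k] \<epsilon>(1)]
        Comp_assoc[OF \<eta>[OF Z] R_hom[OF T.times_arr(1)[OF k]] R_hom[OF \<epsilon>(1)]] by simp
    also have "\<dots> = (amap R \<epsilon> \<cdot> \<eta> E) \<cdot> k"
      using nat[OF Z E k] amap_T[OF k] Comp_assoc[OF k \<eta>[OF E] R_hom[OF \<epsilon>(1)]] by simp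
    finally show ?thesis using \<epsilon>(2) Ide_Comp[OF k] by simp
  qed
  have transpose: "\<exists>!k. k \<in> hom C Z E \<and> \<epsilon> \<cdot> T.times_arr k = h"
    if Z: "Z \<in> Obj C" and h: "h \<in> hom C (omap T Z) Y" for Z h
  proof (rule ex1I)
    have k: "amap R h \<cdot> \<eta> Z \<in> hom C Z E"
      unfolding E_def using Comp_in_hom[OF \<eta>[OF Z] R_hom[OF h]] .
    moreover have "\<epsilon> \<cdot> T.times_arr (amap R h \<cdot> \<eta> Z) = h"
      using univ[OF Z Y k[unfolded E_def]] R\<epsilon>[OF k] h Comp_in_hom[OF T.times_arr(1)[OF k] \<epsilon>(1)] by blast
    ultimately show "amap R h \<cdot> \<eta> Z \<in> hom C Z E \<and> \<epsilon> \<cdot> T.times_arr (amap R h \<cdot> \<eta> Z) = h" ..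
  qed (use R\<epsilon> in auto)
  have "\<exists>i. i \<in> hom C (omap T A) (P A) \<and> p A \<cdot> i = p' A \<and> q A \<cdot> i = q' A"
    if "A \<in> Obj C" for A
    using product_pair[OF product[OF that] T.p_hom[OF that] T.q_hom[OF that]] by metis
  then obtain i where i: "\<And>A. A \<in> Obj C \<Longrightarrow> i A \<in> hom C (omap T A) (P A)"
    and pi: "\<And>A. A \<in> Obj C \<Longrightarrow> p A \<cdot> i A = p' A" "\<And>A. A \<in> Obj C \<Longrightarrow> q A \<cdot> i A = q' A"
    by metis
  have "\<exists>j. j \<in> hom C (P A) (omap T A) \<and> p' A \<cdot> j = p A \<and> q' A \<cdot> j = q A"
    if "A \<in> Obj C" for A
    using product_pair[OF T.product[OF that] p_hom[OF that] q_hom[OF that]] by metis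
  then obtain j where j: "\<And>A. A \<in> Obj C \<Longrightarrow> j A \<in> hom C (P A) (omap T A)"
    and pj: "\<And>A. A \<in> Obj C \<Longrightarrow> p' A \<cdot> j A = p A" "\<And>A. A \<in> Obj C \<Longrightarrow> q' A \<cdot> j A = q A"
    by metis
  have ij: "i A \<cdot> j A = Ide C (P A)" if A: "A \<in> Obj C" for A
    using product_eqI[OF product[OF A] Comp_in_hom[OF j[OF A] i[OF A]] Ide_in_hom[OF P_Obj[OF A]]]
      Comp_assoc[OF j[OF A] i[OF A] p_hom[OF A]] Comp_assoc[OF j[OF A] i[OF A] q_hom[OF A]]
      Comp_Ide[OF p_hom[OF A]] Comp_Ide[OF q_hom[OF A]] by (simp add: pi pj A)
  have ji: "j A \<cdot> i A = Ide C (omap T A)" if A: "A \<in> Obj C" for A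
    using product_eqI[OF T.product[OF A] Comp_in_hom[OF i[OF A] j[OF A]]
        Ide_in_hom[OF T.P_Obj[OF A]]]
      Comp_assoc[OF i[OF A] j[OF A] T.p_hom[OF A]] Comp_assoc[OF i[OF A] j[OF A] T.q_hom[OF A]]
      Comp_Ide[OF T.p_hom[OF A]] Comp_Ide[OF T.q_hom[OF A]] by (simp add: pi pj A)
  have times_arr_j: "T.times_arr k \<cdot> j Z = j E \<cdot> times_arr k" if k: "k \<in> hom C Z E" for k Z
  proof (rule product_eqI[OF T.product[OF E]])
    have Z: "Z \<in> Obj C" using hom_Obj k by blast
    show "T.times_arr k \<cdot> j Z \<in> hom C (P Z) (omap T E)" using Comp_in_hom[OF j[OF Z] T.times_arr(1)[OF k]] .
    show "j E \<cdot> times_arr k \<in> hom C (P Z) (omap T E)" using Comp_in_hom[OF times_arr(1)[OF k] j[OF E]] .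
    have "p' E \<cdot> (T.times_arr k \<cdot> j Z) = k \<cdot> (p' Z \<cdot> j Z)"
      using Comp_assoc[OF j[OF Z] T.times_arr(1)[OF k] T.p_hom[OF E]] T.times_arr(2)[OF k]
        Comp_assoc[OF j[OF Z] T.p_hom[OF Z] k] by simp
    then show "p' E \<cdot> (T.times_arr k \<cdot> j Z) = p' E \<cdot> (j E \<cdot> times_arr k)"
      using Comp_assoc[OF times_arr(1)[OF k] j[OF E] T.p_hom[OF E]] pj(1)[OF E] pj(1)[OF Z] times_arr(2)[OF k]
      by simp
    have "q' E \<cdot> (T.times_arr k \<cdot> j Z) = q' Z \<cdot> j Z"
      using Comp_assoc[OF j[OF Z] T.times_arr(1)[OF k] T.q_hom[OF E]] T.times_arr(3)[OF k] by simp
    then show "q' E \<cdot> (T.times_arr k \<cdot> j Z) = q' E \<cdot> (j E \<cdot> times_arr k)"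
      using Comp_assoc[OF times_arr(1)[OF k] j[OF E] T.q_hom[OF E]] pj(2)[OF E] pj(2)[OF Z] times_arr(3)[OF k]
      by simp
  qed
  define ev where "ev = \<epsilon> \<cdot> j E"
  have ev: "ev \<in> hom C (P E) Y" unfolding ev_def using Comp_in_hom[OF j[OF E] \<epsilon>(1)] .
  have ev_times_arr: "ev \<cdot> times_arr k = (\<epsilon> \<cdot> T.times_arr k) \<cdot> j Z" if k: "k \<in> hom C Z E" for k Z
    unfolding ev_def using times_arr_j[OF k] Comp_assoc[OF times_arr(1)[OF k] j[OF E] \<epsilon>(1)]
      Comp_assoc[OF j[OF hom_Obj(1)[OF k]] T.times_arr(1)[OF k] \<epsilon>(1)] by simp
  have "(ev \<cdot> times_arr k = h) = (\<epsilon> \<cdot> T.times_arr k = h \<cdot> i Z)"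
    if k: "k \<in> hom C Z E" and h: "h \<in> hom C (P Z) Y" for k h Z
  proof -
    have Z: "Z \<in> Obj C" using hom_Obj k by blast
    have e: "\<epsilon> \<cdot> T.times_arr k \<in> hom C (omap T Z) Y" using Comp_in_hom[OF T.times_arr(1)[OF k] \<epsilon>(1)] .
    show ?thesis
      using ev_times_arr[OF k] Comp_assoc[OF i[OF Z] j[OF Z] e] Comp_assoc[OF j[OF Z] i[OF Z] h]
        ij[OF Z] ji[OF Z] Comp_Ide[OF e] Comp_Ide[OF h] by metis
  qed
  then have "\<exists>!k. k \<in> hom C Z E \<and> ev \<cdot> times_arr k = h" if "Z \<in> Obj C" "h \<in> hom C (P Z) Y" for Z h
    using transpose[OF that(1) Comp_in_hom[OF i[OF that(1)] that(2)]] that by (metis (no_types, lifting))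
  then have "is_exponential C P p q Y E ev"
    unfolding is_exponential_iff_times_arr using E ev by blast
  then show ?thesis by blast
qed

end


section \<open>Topological functors to sets, elementwise\<close>

context set_universe
begin

lemma small_singleton: "small {a}"
  using small_pair[of a a] by simp

text \<open>
  A union of two sets is a union over a two-point index set, and the coded power set of a
  singleton supplies the two points.
\<close>

lemma small_Un:
  assumes "small A" "small B"
  shows "small (A \<union> B)"
proof -
  obtain P code where P: "small P" "bij_betw code (Pow {undefined :: 'u}) P"
    using small_Pow[OF small_singleton] by blast
  let ?F = "\<lambda>i. if i = code {} then A else B"
  have "code {} \<noteq> code {undefined}" "code {} \<in> P" "code {undefined} \<in> P"
    using P(2) by (auto simp: bij_betw_def inj_on_def)
  then have "A \<union> B \<subseteq> (\<Union>i\<in>P. ?F i)"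
    by force
  moreover have "small (\<Union>i\<in>P. ?F i)"
    using P(1) assms by (intro small_Union) auto
  ultimately show ?thesis by (rule small_subset[rotated])
qed

text \<open>
  The pair of \<open>a\<close> and \<open>b\<close> is coded as Kuratowski's \<open>{{a}, {a, b}}\<close>, an element of the coded
  double power set of \<open>A \<union> B\<close>.
\<close>

lemma small_Times:
  assumes "small A" "small B"
  shows "\<exists>P code. small P \<and> bij_betw code (A \<times> B) P"
proof -
  obtain P1 c1 where P1: "small P1" "bij_betw c1 (Pow (A \<union> B)) P1"
    using small_Pow[OF small_Un[OF assms]] by blast
  obtain P2 c2 where P2: "small P2" "bij_betw c2 (Pow P1) P2"
    using small_Pow[OF P1(1)] by blast
  let ?c = "\<lambda>(a, b). c2 {c1 {a}, c1 {a, b}}"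
  have c1: "c1 S = c1 S' \<longleftrightarrow> S = S'" if "S \<subseteq> A \<union> B" "S' \<subseteq> A \<union> B" for S S'
    using P1(2) that by (auto simp: bij_betw_def dest: inj_onD)
  have c1_in: "c1 S \<in> P1" if "S \<subseteq> A \<union> B" for S
    using P1(2) that by (auto simp: bij_betw_def)
  have inj2: "c2 S = c2 S' \<longleftrightarrow> S = S'" if "S \<subseteq> P1" "S' \<subseteq> P1" for S S'
    using P2(2) that by (auto simp: bij_betw_def dest: inj_onD)
  have "inj_on ?c (A \<times> B)"
  proof (rule inj_onI, clarify)
    fix a b a' b'
    assume ab: "a \<in> A" "b \<in> B" "a' \<in> A" "b' \<in> B"
      and "c2 {c1 {a}, c1 {a, b}} = c2 {c1 {a'}, c1 {a', b'}}"
    then have "{c1 {a}, c1 {a, b}} = {c1 {a'}, c1 {a', b'}}"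
      by (subst (asm) inj2) (auto intro!: c1_in)
    then show "a = a' \<and> b = b'"
      using ab by (simp add: doubleton_eq_iff c1) blast
  qed
  moreover have "?c ` (A \<times> B) \<subseteq> P2"
    using P2(2) c1_in by (auto simp: bij_betw_def)
  ultimately show ?thesis
    using small_subset[OF P2(1)] by (blast intro: inj_on_imp_bij_betw)
qed

lemma hom_Sets:
  "h \<in> hom (Sets small) A B \<longleftrightarrow> small A \<and> small B \<and> (\<exists>f\<in>A \<rightarrow>\<^sub>E B. h = Arrow A f B)"
  unfolding hom_def Sets_def by auto

lemma Comp_Sets:
  "Arrow B g D \<cdot>\<^bsub>Sets small\<^esub> Arrow A f B = Arrow A (compose A g f) D"
  unfolding Sets_def by simp

lemma Obj_Sets: "A \<in> Obj (Sets small) \<longleftrightarrow> small A"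
  unfolding Sets_def by simp

end

locale topological_over_sets = set_universe small + category X
  for small :: "'u set \<Rightarrow> bool" and X :: "('o, 'm) category" (structure) +
  fixes U :: "('o, 'm, 'u) set_functor"
  assumes topological: "topological X (Sets small) U"
begin

abbreviation el :: "'o \<Rightarrow> 'u set"
  where "el A \<equiv> omap U A"

abbreviation fn :: "'m \<Rightarrow> 'u \<Rightarrow> 'u"
  where "fn f \<equiv> body (amap U f)"

lemma small_el: "A \<in> Obj X \<Longrightarrow> small (el A)"
  using topological unfolding topological_def is_functor_def Obj_Sets by blast

lemma amap_hom: "f \<in> hom X A B \<Longrightarrow> amap U f \<in> hom (Sets small) (el A) (el B)"
  using topological hom_Obj[of f A B] unfolding topological_def is_functor_def by blast

lemma amap_eq: "f \<in> hom X A B \<Longrightarrow> amap U f = Arrow (el A) (fn f) (el B)"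
  using amap_hom[of f A B] by (auto simp: hom_Sets)

text \<open>
  The previous equation rewrites to a term that contains its left-hand side; the following two
  forms serve for rewriting.
\<close>

lemma amap_eq_iff: "f \<in> hom X A B \<Longrightarrow> amap U f = Arrow (el A) \<phi> (el B) \<longleftrightarrow> fn f = \<phi>"
  by (metis amap_eq arrow.sel(2))

lemma amap_Comp_Arrow: "f \<in> hom X A B \<Longrightarrow>
    amap U f \<cdot>\<^bsub>Sets small\<^esub> Arrow D \<phi> (el A) = Arrow D (compose D (fn f) \<phi>) (el B)"
  by (subst amap_eq[of f A B], assumption, rule Comp_Sets)

lemma fn_PiE: "f \<in> hom X A B \<Longrightarrow> fn f \<in> el A \<rightarrow>\<^sub>E el B"
  using amap_hom[of f A B] by (auto simp: hom_Sets)

lemma fn_in: "\<lbrakk>f \<in> hom X A B; x \<in> el A\<rbrakk> \<Longrightarrow> fn f x \<in> el B"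
  using fn_PiE by blast

lemma fn_Comp:
  assumes "f \<in> hom X A B" "g \<in> hom X B D" "x \<in> el A"
  shows "fn (g \<cdot> f) x = fn g (fn f x)"
proof -
  have "amap U (g \<cdot> f) = amap U g \<cdot>\<^bsub>Sets small\<^esub> amap U f"
    using topological assms hom_Obj unfolding topological_def is_functor_def by blast
  also have "\<dots> = Arrow (el A) (compose (el A) (fn g) (fn f)) (el D)"
    by (subst amap_eq[OF assms(1)]) (rule amap_Comp_Arrow[OF assms(2)])
  finally show ?thesis using assms(3) by (simp add: compose_def)
qed

lemma fn_Ide: "A \<in> Obj X \<Longrightarrow> x \<in> el A \<Longrightarrow> fn (Ide X A) x = x"
  using topological unfolding topological_def is_functor_def by (simp add: Sets_def)

text \<open>
  If \<open>f\<close> and \<open>g\<close> have the same underlying map \<open>\<phi>\<close> into the underlying set of \<open>B\<close>, then \<open>(Ide A, f)\<close>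
  and \<open>(Ide A, g)\<close> both are initial lifts of the structured source that consists of the identity
  and \<open>\<phi>\<close>; initiality is automatic as the source contains the identity of the lift. Uniqueness of
  initial lifts forces \<open>f = g\<close>.
\<close>

lemma faithful:
  assumes f: "f \<in> hom X A B" and g: "g \<in> hom X A B" and eq: "amap U f = amap U g"
  shows "f = g"
proof -
  let ?idA = "amap U (Ide X A)"
  define S where "S = {(A, ?idA), (B, amap U f)}"
  have O: "A \<in> Obj X" "B \<in> Obj X" using hom_Obj f by auto
  have source: "structured_source X (Sets small) U (el A) S"
    unfolding structured_source_def S_def
    using O amap_hom[OF Ide_in_hom] amap_hom[OF f] small_el by (auto simp: Obj_Sets)
  define l where "l e = (\<lambda>s\<in>S. if s = (B, amap U f) then e else Ide X A)" for e
  have lift: "is_initial_lift X (Sets small) U (el A) S A (l e)"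
    if e: "e \<in> hom X A B" "amap U e = amap U f" for e
    unfolding is_initial_lift_def
  proof (intro conjI ballI impI)
    fix Z h
    assume Z: "Z \<in> Obj X" and h: "h \<in> hom (Sets small) (el Z) (el A)"
      and *: "\<forall>(Y, \<phi>)\<in>S. \<exists>k\<in>hom X Z Y. amap U (l e (Y, \<phi>)) \<cdot>\<^bsub>Sets small\<^esub> h = amap U k"
    have "amap U (l e (A, ?idA)) = ?idA" using e(2) unfolding l_def S_def by auto
    then obtain k where "k \<in> hom X Z A" "?idA \<cdot>\<^bsub>Sets small\<^esub> h = amap U k"
      using * unfolding S_def by auto
    moreover obtain h' where h': "h = Arrow (el Z) h' (el A)" "h' \<in> el Z \<rightarrow>\<^sub>E el A"
      using h by (auto simp: hom_Sets)
    have "?idA \<cdot>\<^bsub>Sets small\<^esub> h = h"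
      unfolding h'(1) amap_Comp_Arrow[OF Ide_in_hom[OF O(1)]]
      using h'(2) fn_Ide[OF O(1)]
      by (auto simp: compose_def PiE_iff intro!: extensionalityI[of _ "el Z"])
    ultimately show "\<exists>k\<in>hom X Z A. amap U k = h" by auto
  qed (use O e Ide_in_hom in \<open>auto simp: l_def S_def\<close>)
  have "\<exists>!(A', l). is_initial_lift X (Sets small) U (el A) S A' l"
    using topological source unfolding topological_def by blast
  then have "l f = l g"
    using lift[OF f] lift[OF g] eq by auto
  then have "l f (B, amap U f) = l g (B, amap U f)" by simp
  then show ?thesis by (simp add: l_def S_def)
qed

lemma hom_eqI:
  assumes "f \<in> hom X A B" "g \<in> hom X A B" "\<And>x. x \<in> el A \<Longrightarrow> fn f x = fn g x"
  shows "f = g"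
proof (rule faithful[OF assms(1,2)])
  have "fn f = fn g"
    using PiE_ext[OF fn_PiE[OF assms(1)] fn_PiE[OF assms(2)]] assms(3) by auto
  then show "amap U f = amap U g"
    by (subst amap_eq[OF assms(2)]) (simp add: amap_eq_iff[OF assms(1)])
qed

lemma Comp_eqD:
  assumes "g \<cdot> f = h" "f \<in> hom X A B" "g \<in> hom X B D" "x \<in> el A"
  shows "fn g (fn f x) = fn h x"
  using assms(1) fn_Comp[OF assms(2-4)] by simp

lemma Comp_eqI:
  assumes "f \<in> hom X A B" "g \<in> hom X B D" "h \<in> hom X A D"
    and "\<And>x. x \<in> el A \<Longrightarrow> fn g (fn f x) = fn h x"
  shows "g \<cdot> f = h"
  using assms Comp_in_hom fn_Comp by (intro hom_eqI[of _ A D]) auto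

text \<open>
  Initial lifts in terms of plain functions: \<open>S\<close> lists the maps that have to become morphisms, and
  a map into the lift is a morphism as soon as its composites with all of them are.
\<close>

lemma ex_initial_structure:
  assumes A: "small A" and S: "\<And>B \<phi>. (B, \<phi>) \<in> S \<Longrightarrow> B \<in> Obj X \<and> \<phi> \<in> A \<rightarrow> el B"
  obtains A' where "A' \<in> Obj X" "el A' = A"
    and "\<And>B \<phi>. (B, \<phi>) \<in> S \<Longrightarrow> \<exists>g\<in>hom X A' B. \<forall>x\<in>A. fn g x = \<phi> x"
    and "\<And>Z h. \<lbrakk>Z \<in> Obj X; h \<in> el Z \<rightarrow> A;
        \<And>B \<phi>. (B, \<phi>) \<in> S \<Longrightarrow> \<exists>k\<in>hom X Z B. \<forall>z\<in>el Z. fn k z = \<phi> (h z)\<rbrakk>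
      \<Longrightarrow> \<exists>h'\<in>hom X Z A'. \<forall>z\<in>el Z. fn h' z = h z"
proof -
  define ar where "ar B \<phi> = Arrow A (restrict \<phi> A) (el B)" for B and \<phi> :: "'u \<Rightarrow> 'u"
  define S' where "S' = {(B, ar B \<phi>) | B \<phi>. (B, \<phi>) \<in> S}"
  have "structured_source X (Sets small) U A S'"
    unfolding structured_source_def S'_def ar_def
    using A S small_el by (auto simp: Obj_Sets hom_Sets)
  then obtain A' l where "is_initial_lift X (Sets small) U A S' A' l"
    using topological unfolding topological_def by blast
  then have A': "A' \<in> Obj X" "el A' = A"
    and l: "\<And>B \<psi>. (B, \<psi>) \<in> S' \<Longrightarrow> l (B, \<psi>) \<in> hom X A' B \<and> amap U (l (B, \<psi>)) = \<psi>"
    and univ: "\<And>Z h. \<lbrakk>Z \<in> Obj X; h \<in> hom (Sets small) (el Z) (el A');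
      \<forall>(B, \<psi>)\<in>S'. \<exists>k\<in>hom X Z B. amap U (l (B, \<psi>)) \<cdot>\<^bsub>Sets small\<^esub> h = amap U k\<rbrakk>
      \<Longrightarrow> \<exists>h'\<in>hom X Z A'. amap U h' = h"
    unfolding is_initial_lift_def by auto
  have S': "(B, ar B \<phi>) \<in> S'" if "(B, \<phi>) \<in> S" for B \<phi>
    using that unfolding S'_def by blast
  show thesis
  proof (rule that[OF A'])
    fix B \<phi> assume "(B, \<phi>) \<in> S"
    then show "\<exists>g\<in>hom X A' B. \<forall>x\<in>A. fn g x = \<phi> x"
      using l[OF S'[of B \<phi>]] unfolding ar_def by (intro bexI[of _ "l (B, ar B \<phi>)"]) (auto simp: ar_def)
  next
    fix Z h
    assume Z: "Z \<in> Obj X" and h: "h \<in> el Z \<rightarrow> A"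
      and ks: "\<And>B \<phi>. (B, \<phi>) \<in> S \<Longrightarrow> \<exists>k\<in>hom X Z B. \<forall>z\<in>el Z. fn k z = \<phi> (h z)"
    have "\<exists>h'\<in>hom X Z A'. amap U h' = Arrow (el Z) (restrict h (el Z)) A"
    proof (rule univ[OF Z])
      show "Arrow (el Z) (restrict h (el Z)) A \<in> hom (Sets small) (el Z) (el A')"
        using h A' A small_el[OF Z] by (auto simp: hom_Sets)
      have "\<exists>k\<in>hom X Z B. amap U (l (B, ar B \<phi>)) \<cdot>\<^bsub>Sets small\<^esub>
          Arrow (el Z) (restrict h (el Z)) A = amap U k" if B: "(B, \<phi>) \<in> S" for B \<phi>
      proof -
        obtain k where k: "k \<in> hom X Z B" "\<And>z. z \<in> el Z \<Longrightarrow> fn k z = \<phi> (h z)"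
          using ks[OF B] by blast
        have "compose (el Z) (restrict \<phi> A) (restrict h (el Z)) = fn k"
          using k h fn_PiE[OF k(1)]
          by (intro extensionalityI[of _ "el Z"]) (auto simp: compose_def PiE_def)
        then have "amap U (l (B, ar B \<phi>)) \<cdot>\<^bsub>Sets small\<^esub> Arrow (el Z) (restrict h (el Z)) A = amap U k"
          using l[OF S'[OF B]] by (simp add: ar_def Comp_Sets flip: amap_eq[OF k(1)])
        then show ?thesis using k(1) by blast
      qed
      then show "\<forall>(B, \<psi>)\<in>S'. \<exists>k\<in>hom X Z B. amap U (l (B, \<psi>)) \<cdot>\<^bsub>Sets small\<^esub>
          Arrow (el Z) (restrict h (el Z)) A = amap U k"
        unfolding S'_def by blast
    qed
    then obtain h' where "h' \<in> hom X Z A'" "amap U h' = Arrow (el Z) (restrict h (el Z)) A"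
      by blast
    then show "\<exists>h'\<in>hom X Z A'. \<forall>z\<in>el Z. fn h' z = h z"
      by (intro bexI[of _ h']) auto
  qed
qed

lemma initial_morphismI:
  assumes f: "f \<in> hom X A B"
    and lift: "\<And>Z h k. \<lbrakk>h \<in> el Z \<rightarrow> el A; k \<in> hom X Z B; \<And>z. z \<in> el Z \<Longrightarrow> fn f (h z) = fn k z\<rbrakk>
      \<Longrightarrow> \<exists>h'\<in>hom X Z A. \<forall>z\<in>el Z. fn h' z = h z"
  shows "initial_morphism X (Sets small) U A B f"
  unfolding initial_morphism_def
proof (intro conjI ballI impI)
  fix Z h
  assume Z: "Z \<in> Obj X" and h: "h \<in> hom (Sets small) (el Z) (el A)"
    and "\<exists>k\<in>hom X Z B. amap U f \<cdot>\<^bsub>Sets small\<^esub> h = amap U k"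
  then obtain k where k: "k \<in> hom X Z B" "amap U f \<cdot>\<^bsub>Sets small\<^esub> h = amap U k" by blast
  obtain \<chi> where \<chi>: "h = Arrow (el Z) \<chi> (el A)" "\<chi> \<in> el Z \<rightarrow>\<^sub>E el A"
    using h by (auto simp: hom_Sets)
  have "amap U k = Arrow (el Z) (compose (el Z) (fn f) \<chi>) (el B)"
    using k(2) \<chi>(1) amap_Comp_Arrow[OF f] by simp
  then have eq: "fn f (\<chi> z) = fn k z" if "z \<in> el Z" for z
    using that by (simp add: compose_def)
  have "\<chi> \<in> el Z \<rightarrow> el A" using \<chi>(2) by auto
  from lift[OF this k(1) eq] obtain h' where h': "h' \<in> hom X Z A" "\<forall>z\<in>el Z. fn h' z = \<chi> z"
    by blast
  then have "fn h' = \<chi>" using PiE_ext[OF fn_PiE[OF h'(1)] \<chi>(2)] by simp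
  then show "\<exists>h'\<in>hom X Z A. amap U h' = h"
    using h'(1) \<chi>(1) amap_eq_iff[OF h'(1)] by auto
qed (use f hom_Obj[OF f] in auto)

lemma initial_morphismD:
  assumes "initial_morphism X (Sets small) U A B f"
    and h: "h \<in> el Z \<rightarrow> el A" and k: "k \<in> hom X Z B" and eq: "\<And>z. z \<in> el Z \<Longrightarrow> fn f (h z) = fn k z"
  shows "\<exists>h'\<in>hom X Z A. \<forall>z\<in>el Z. fn h' z = h z"
proof -
  have f: "f \<in> hom X A B" and A: "A \<in> Obj X" and Z: "Z \<in> Obj X"
    using assms hom_Obj[OF k] by (auto simp: initial_morphism_def)
  let ?h = "Arrow (el Z) (restrict h (el Z)) (el A)"
  have "?h \<in> hom (Sets small) (el Z) (el A)"
    using h A Z small_el by (auto simp: hom_Sets)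
  moreover have "compose (el Z) (fn f) (restrict h (el Z)) = fn k"
    using eq fn_PiE[OF k]
    by (auto simp: compose_def PiE_def intro!: extensionalityI[of _ "el Z"])
  then have "amap U f \<cdot>\<^bsub>Sets small\<^esub> ?h = amap U k"
    unfolding amap_Comp_Arrow[OF f] by (simp flip: amap_eq[OF k])
  ultimately obtain h' where "h' \<in> hom X Z A" "amap U h' = ?h"
    using assms(1) Z k unfolding initial_morphism_def by blast
  then show ?thesis by (intro bexI[of _ h']) auto
qed

subsection \<open>Products\<close>

text \<open>
  In addition to the universal property, the points of the product are required to correspond to the
  pairs of points of the factors, so that statements about the product can be checked on points.
\<close>

definition concrete_product :: "'o \<Rightarrow> 'o \<Rightarrow> 'o \<times> 'm \<times> 'm \<Rightarrow> bool"
  where "concrete_product A B = (\<lambda>(P, p, q).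
    P \<in> Obj X \<and> p \<in> hom X P A \<and> q \<in> hom X P B \<and>
    bij_betw (\<lambda>z. (fn p z, fn q z)) (el P) (el A \<times> el B) \<and>
    (\<forall>Z f g. f \<in> hom X Z A \<longrightarrow> g \<in> hom X Z B \<longrightarrow> (\<exists>m\<in>hom X Z P. p \<cdot> m = f \<and> q \<cdot> m = g)))"

lemma ex_concrete_product:
  assumes A: "A \<in> Obj X" and B: "B \<in> Obj X"
  shows "\<exists>t. concrete_product A B t"
proof -
  obtain P0 code where P0: "small P0" "bij_betw code (el A \<times> el B) P0"
    using small_Times[OF small_el[OF A] small_el[OF B]] by blast
  define d where "d = inv_into (el A \<times> el B) code"
  have d: "bij_betw d P0 (el A \<times> el B)"
    unfolding d_def using bij_betw_inv_into[OF P0(2)] .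
  have d_code: "d (code (a, b)) = (a, b)" "code (a, b) \<in> P0" if "a \<in> el A" "b \<in> el B" for a b
    unfolding d_def using P0(2) that
    by (auto simp: bij_betw_def inv_into_f_f)
  let ?S = "{(A, fst \<circ> d), (B, snd \<circ> d)}"
  have dP: "d x \<in> el A \<times> el B" if "x \<in> P0" for x
    using d that bij_betwE by blast
  obtain P where P: "P \<in> Obj X" "el P = P0"
    and pr: "\<And>D \<phi>. (D, \<phi>) \<in> ?S \<Longrightarrow> \<exists>g\<in>hom X P D. \<forall>x\<in>P0. fn g x = \<phi> x"
    and lift: "\<And>Z h. \<lbrakk>Z \<in> Obj X; h \<in> el Z \<rightarrow> P0;
        \<And>D \<phi>. (D, \<phi>) \<in> ?S \<Longrightarrow> \<exists>k\<in>hom X Z D. \<forall>z\<in>el Z. fn k z = \<phi> (h z)\<rbrakk>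
      \<Longrightarrow> \<exists>h'\<in>hom X Z P. \<forall>z\<in>el Z. fn h' z = h z"
  proof (rule ex_initial_structure[OF P0(1), of ?S])
    fix D \<phi> assume "(D, \<phi>) \<in> ?S"
    then show "D \<in> Obj X \<and> \<phi> \<in> P0 \<rightarrow> el D" using A B dP by (auto simp: mem_Times_iff)
  qed blast
  obtain p where p: "p \<in> hom X P A" "\<And>x. x \<in> P0 \<Longrightarrow> fn p x = fst (d x)"
    using pr[of A "fst \<circ> d"] by auto
  obtain q where q: "q \<in> hom X P B" "\<And>x. x \<in> P0 \<Longrightarrow> fn q x = snd (d x)"
    using pr[of B "snd \<circ> d"] by auto
  have "bij_betw (\<lambda>z. (fn p z, fn q z)) (el P) (el A \<times> el B)"
    using d bij_betw_cong[of P0 d "\<lambda>z. (fn p z, fn q z)"] by (simp add: P(2) p(2) q(2))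
  moreover have "\<exists>m\<in>hom X Z P. p \<cdot> m = f \<and> q \<cdot> m = g"
    if f: "f \<in> hom X Z A" and g: "g \<in> hom X Z B" for Z f g
  proof -
    define h where "h z = code (fn f z, fn g z)" for z
    have h: "h z \<in> P0" "d (h z) = (fn f z, fn g z)" if "z \<in> el Z" for z
      using d_code fn_in[OF f that] fn_in[OF g that] unfolding h_def by auto
    have "\<exists>m\<in>hom X Z P. \<forall>z\<in>el Z. fn m z = h z"
      using h f g by (intro lift) (use hom_Obj[OF f] in auto)
    then obtain m where m: "m \<in> hom X Z P" "\<And>z. z \<in> el Z \<Longrightarrow> fn m z = h z" by blast
    have "p \<cdot> m = f" by (rule Comp_eqI[OF m(1) p(1) f]) (simp add: m p h)
    moreover have "q \<cdot> m = g" by (rule Comp_eqI[OF m(1) q(1) g]) (simp add: m q h)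
    ultimately show ?thesis using m(1) by blast
  qed
  ultimately have "concrete_product A B (P, p, q)"
    using P(1) p(1) q(1) by (auto simp: concrete_product_def)
  then show ?thesis ..
qed

definition prd :: "'o \<Rightarrow> 'o \<Rightarrow> 'o"
  where "prd A B = fst (SOME t. concrete_product A B t)"

definition pr1 :: "'o \<Rightarrow> 'o \<Rightarrow> 'm"
  where "pr1 A B = fst (snd (SOME t. concrete_product A B t))"

definition pr2 :: "'o \<Rightarrow> 'o \<Rightarrow> 'm"
  where "pr2 A B = snd (snd (SOME t. concrete_product A B t))"

context
  fixes A B
  assumes A: "A \<in> Obj X" and B: "B \<in> Obj X"
begin

lemma prd_concrete: "concrete_product A B (prd A B, pr1 A B, pr2 A B)"
  unfolding prd_def pr1_def pr2_def using someI_ex[OF ex_concrete_product[OF A B]] by simp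

lemma prd_Obj: "prd A B \<in> Obj X"
  and pr1_hom: "pr1 A B \<in> hom X (prd A B) A"
  and pr2_hom: "pr2 A B \<in> hom X (prd A B) B"
  using prd_concrete by (auto simp: concrete_product_def)

lemma prd_bij: "bij_betw (\<lambda>z. (fn (pr1 A B) z, fn (pr2 A B) z)) (el (prd A B)) (el A \<times> el B)"
  using prd_concrete by (auto simp: concrete_product_def)

lemma prd_el_eqI:
  assumes "z \<in> el (prd A B)" "z' \<in> el (prd A B)"
    and "fn (pr1 A B) z = fn (pr1 A B) z'" "fn (pr2 A B) z = fn (pr2 A B) z'"
  shows "z = z'"
  using bij_betw_imp_inj_on[OF prd_bij] assms by (auto dest: inj_onD)

lemma prd_el_ex:
  assumes "a \<in> el A" "b \<in> el B"
  obtains z where "z \<in> el (prd A B)" "fn (pr1 A B) z = a" "fn (pr2 A B) z = b"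
proof -
  have "(a, b) \<in> (\<lambda>z. (fn (pr1 A B) z, fn (pr2 A B) z)) ` el (prd A B)"
    using bij_betw_imp_surj_on[OF prd_bij] assms by auto
  then obtain z where "z \<in> el (prd A B)" "(a, b) = (fn (pr1 A B) z, fn (pr2 A B) z)"
    by blast
  then show thesis using that[of z] by simp
qed

lemma pair_ex:
  assumes "f \<in> hom X Z A" "g \<in> hom X Z B"
  obtains m where "m \<in> hom X Z (prd A B)" "pr1 A B \<cdot> m = f" "pr2 A B \<cdot> m = g"
proof -
  have "\<exists>m\<in>hom X Z (prd A B). pr1 A B \<cdot> m = f \<and> pr2 A B \<cdot> m = g"
    using prd_concrete assms by (simp add: concrete_product_def)
  then show thesis using that by blast
qed

lemma prd_hom_eqI:
  assumes m: "m \<in> hom X Z (prd A B)" "m' \<in> hom X Z (prd A B)"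
    and eq: "pr1 A B \<cdot> m = pr1 A B \<cdot> m'" "pr2 A B \<cdot> m = pr2 A B \<cdot> m'"
  shows "m = m'"
proof (rule hom_eqI[OF m])
  fix z assume z: "z \<in> el Z"
  have "fn (pr1 A B) (fn m z) = fn (pr1 A B) (fn m' z)"
    "fn (pr2 A B) (fn m z) = fn (pr2 A B) (fn m' z)"
    using Comp_eqD[OF eq(1) m(1) pr1_hom z] Comp_eqD[OF eq(2) m(1) pr2_hom z]
      fn_Comp[OF m(2) pr1_hom z] fn_Comp[OF m(2) pr2_hom z] by auto
  then show "fn m z = fn m' z"
    by (rule prd_el_eqI[OF fn_in[OF m(1) z] fn_in[OF m(2) z]])
qed

lemma prd_product: "is_product X A B (prd A B) (pr1 A B) (pr2 A B)"
  unfolding is_product_def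
proof (intro conjI ballI prd_Obj pr1_hom pr2_hom)
  fix Z f g
  assume "f \<in> hom X Z A" "g \<in> hom X Z B"
  then obtain m where "m \<in> hom X Z (prd A B)" "pr1 A B \<cdot> m = f" "pr2 A B \<cdot> m = g"
    by (rule pair_ex)
  then show "\<exists>!m. m \<in> hom X Z (prd A B) \<and> pr1 A B \<cdot> m = f \<and> pr2 A B \<cdot> m = g"
    by (auto intro: prd_hom_eqI)
qed

end

text \<open>
  The terminal object carries the initial structure with respect to the empty source on a
  one-element set.
\<close>

lemma ex_terminal:
  obtains T t where "T \<in> Obj X" "el T = {t}" "\<And>Z. Z \<in> Obj X \<Longrightarrow> \<exists>f. f \<in> hom X Z T"
proof -
  let ?S = "{} :: ('o \<times> ('u \<Rightarrow> 'u)) set"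
  obtain T where T: "T \<in> Obj X" "el T = {undefined}"
    and lift: "\<And>Z h. \<lbrakk>Z \<in> Obj X; h \<in> el Z \<rightarrow> {undefined};
        \<And>B \<phi>. (B, \<phi>) \<in> ?S \<Longrightarrow> \<exists>k\<in>hom X Z B. \<forall>z\<in>el Z. fn k z = \<phi> (h z)\<rbrakk>
      \<Longrightarrow> \<exists>h'\<in>hom X Z T. \<forall>z\<in>el Z. fn h' z = h z"
    by (rule ex_initial_structure[OF small_singleton, of ?S undefined]) auto
  show thesis
  proof (rule that[OF T])
    fix Z assume "Z \<in> Obj X"
    from lift[OF this, of "\<lambda>_. undefined"] show "\<exists>f. f \<in> hom X Z T" by auto
  qed
qed

end


section \<open>Separated and injective objects\<close>

locale ordered_topological = topological_over_sets small X U
  for small :: "'u set \<Rightarrow> bool" and X :: "('o, 'm) category" (structure)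
    and U :: "('o, 'm, 'u) set_functor" +
  fixes le :: "'m \<Rightarrow> 'm \<Rightarrow> bool"
  assumes enriched: "preorder_enriched X le"
begin

abbreviation sep :: "'o \<Rightarrow> bool"
  where "sep \<equiv> separated X le"

abbreviation inj_obj :: "'o \<Rightarrow> bool"
  where "inj_obj \<equiv> injective_object X (Sets small) U le"

lemma simeq_refl: "f \<in> hom X A B \<Longrightarrow> simeq le f f"
  using enriched hom_Obj[of f A B] unfolding preorder_enriched_def simeq_def reflp_on_def by blast

lemma simeq_Comp:
  assumes "f \<in> hom X A B" "f' \<in> hom X A B" "simeq le f f'" "g \<in> hom X B D"
  shows "simeq le (g \<cdot> f) (g \<cdot> f')"
  using enriched assms simeq_refl[OF assms(4)] hom_Obj[OF assms(1)] hom_Obj[OF assms(4)]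
  unfolding preorder_enriched_def simeq_def by blast

lemma sep_Obj: "sep A \<Longrightarrow> A \<in> Obj X"
  by (simp add: separated_def)

lemma sepI:
  assumes "A \<in> Obj X"
    and "\<And>Y f g. \<lbrakk>f \<in> hom X Y A; g \<in> hom X Y A; simeq le f g\<rbrakk> \<Longrightarrow> f = g"
  shows "sep A"
  using assms unfolding separated_def by blast

lemma sepD: "\<lbrakk>sep A; f \<in> hom X Y A; g \<in> hom X Y A; simeq le f g\<rbrakk> \<Longrightarrow> f = g"
  using hom_Obj[of f Y A] unfolding separated_def by blast

lemma sep_prd:
  assumes "sep A" "sep B"
  shows "sep (prd A B)"
proof (rule sepI)
  note O = sep_Obj[OF assms(1)] sep_Obj[OF assms(2)]
  show "prd A B \<in> Obj X" using prd_Obj[OF O] .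
  fix Y f g
  assume f: "f \<in> hom X Y (prd A B)" and g: "g \<in> hom X Y (prd A B)" and fg: "simeq le f g"
  have "pr1 A B \<cdot> f = pr1 A B \<cdot> g"
    using Comp_in_hom f g pr1_hom[OF O] simeq_Comp[OF f g fg pr1_hom[OF O]]
    by - (rule sepD[OF assms(1)], auto)
  moreover have "pr2 A B \<cdot> f = pr2 A B \<cdot> g"
    using Comp_in_hom f g pr2_hom[OF O] simeq_Comp[OF f g fg pr2_hom[OF O]]
    by - (rule sepD[OF assms(2)], auto)
  ultimately show "f = g" using prd_hom_eqI[OF O f g] by blast
qed

text \<open>Separatedness turns the extension up to \<open>\<simeq>\<close> into a strict one.\<close>

lemma sep_inj_extend:
  assumes "sep A" "inj_obj A" "initial_morphism X (Sets small) U Y Z y" "f \<in> hom X Y A"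
  obtains f' where "f' \<in> hom X Z A" "f' \<cdot> y = f"
proof -
  obtain f' where f': "f' \<in> hom X Z A" "simeq le (f' \<cdot> y) f"
    using assms unfolding injective_object_def by blast
  have "y \<in> hom X Y Z" using assms(3) by (simp add: initial_morphism_def)
  then have "f' \<cdot> y = f" using sepD[OF assms(1) _ assms(4) f'(2)] Comp_in_hom f'(1) by blast
  then show thesis using that f'(1) by blast
qed

lemma inj_objI:
  assumes "A \<in> Obj X"
    and "\<And>Y Z y f. \<lbrakk>initial_morphism X (Sets small) U Y Z y; y \<in> hom X Y Z; f \<in> hom X Y A\<rbrakk>
      \<Longrightarrow> \<exists>f'\<in>hom X Z A. f' \<cdot> y = f"
  shows "inj_obj A"
  unfolding injective_object_def
proof (intro conjI allI impI ballI)
  fix Y Z y f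
  assume y: "initial_morphism X (Sets small) U Y Z y" and f: "f \<in> hom X Y A"
  then obtain f' where "f' \<in> hom X Z A" "f' \<cdot> y = f"
    using assms(2)[OF y _ f] by (auto simp: initial_morphism_def)
  then show "\<exists>f'\<in>hom X Z A. simeq le (f' \<cdot> y) f" using simeq_refl[OF f] by blast
qed fact

lemma inj_obj_prd:
  assumes A: "sep A" "inj_obj A" and B: "sep B" "inj_obj B"
  shows "inj_obj (prd A B)"
proof (rule inj_objI)
  note O = sep_Obj[OF A(1)] sep_Obj[OF B(1)]
  show "prd A B \<in> Obj X" using prd_Obj[OF O] .
  fix Y Z y f
  assume y: "initial_morphism X (Sets small) U Y Z y" "y \<in> hom X Y Z" and f: "f \<in> hom X Y (prd A B)"
  obtain g where g: "g \<in> hom X Z A" "g \<cdot> y = pr1 A B \<cdot> f"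
    using sep_inj_extend[OF A y(1) Comp_in_hom[OF f pr1_hom[OF O]]] .
  obtain h where h: "h \<in> hom X Z B" "h \<cdot> y = pr2 A B \<cdot> f"
    using sep_inj_extend[OF B y(1) Comp_in_hom[OF f pr2_hom[OF O]]] .
  obtain f' where f': "f' \<in> hom X Z (prd A B)" "pr1 A B \<cdot> f' = g" "pr2 A B \<cdot> f' = h"
    using pair_ex[OF O g(1) h(1)] .
  have "f' \<cdot> y = f"
    using Comp_in_hom[OF y(2) f'(1)] f g(2) h(2) f'(2,3)
      Comp_assoc[OF y(2) f'(1) pr1_hom[OF O]] Comp_assoc[OF y(2) f'(1) pr2_hom[OF O]]
    by - (rule prd_hom_eqI[OF O], auto)
  then show "\<exists>f'\<in>hom X Z (prd A B). f' \<cdot> y = f" using f'(1) by blast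
qed

lemma ex_sep_inj_terminal:
  obtains T t where "sep T" "inj_obj T" "el T = {t}" "\<And>Z. Z \<in> Obj X \<Longrightarrow> \<exists>f. f \<in> hom X Z T"
proof -
  obtain T t where T: "T \<in> Obj X" "el T = {t}" and ex: "\<And>Z. Z \<in> Obj X \<Longrightarrow> \<exists>f. f \<in> hom X Z T"
    by (rule ex_terminal) (rule that; blast)
  have eq: "f = g" if "f \<in> hom X Z T" "g \<in> hom X Z T" for f g Z
    using fn_in[OF that(1)] fn_in[OF that(2)] T(2) by (intro hom_eqI[OF that]) auto
  have "sep T" by (rule sepI[OF T(1)]) (rule eq)
  moreover have "inj_obj T"
  proof (rule inj_objI[OF T(1)])
    fix Y Z y f
    assume y: "y \<in> hom X Y Z" and f: "f \<in> hom X Y T"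
    obtain f' where f': "f' \<in> hom X Z T" using ex hom_Obj[OF y] by blast
    have "f' \<cdot> y = f" using eq[OF Comp_in_hom[OF y f'] f] .
    then show "\<exists>f'\<in>hom X Z T. f' \<cdot> y = f" using f' by blast
  qed
  ultimately show thesis using that T(2) ex by blast
qed

section \<open>The separated reflection\<close>

text \<open>
  The reflection of \<open>A\<close> is the set of representatives of points of \<open>A\<close> modulo the relation of having
  the same image under every morphism into a separated object, with the initial structure with
  respect to all maps induced by such morphisms. This source is point-separating, hence its domain
  is separated: maps into it that agree up to \<open>\<simeq>\<close> agree after composition with the source.
\<close>

lemma ex_separated_reflection:
  assumes A: "A \<in> Obj X"
  shows "\<exists>A' q. sep A' \<and> q \<in> hom X A A' \<and>
    (\<forall>B f. sep B \<longrightarrow> f \<in> hom X A B \<longrightarrow> (\<exists>!g. g \<in> hom X A' B \<and> g \<cdot> q = f))"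
proof -
  define sim where "sim x = {x' \<in> el A. \<forall>B f. sep B \<longrightarrow> f \<in> hom X A B \<longrightarrow> fn f x = fn f x'}" for x
  define rep where "rep x = (SOME x'. x' \<in> sim x)" for x
  have "x \<in> sim x" if "x \<in> el A" for x using that by (simp add: sim_def)
  then have "rep x \<in> sim x" if "x \<in> el A" for x
    unfolding rep_def using that someI by metis
  then have rep: "rep x \<in> el A" and fn_rep: "\<And>B f. \<lbrakk>sep B; f \<in> hom X A B\<rbrakk> \<Longrightarrow> fn f (rep x) = fn f x"
    if "x \<in> el A" for x
    using that unfolding sim_def by auto
  have rep_eqI: "rep x = rep x'"
    if "\<And>B f. \<lbrakk>sep B; f \<in> hom X A B\<rbrakk> \<Longrightarrow> fn f x = fn f x'" for x x'
  proof -
    have "sim x = sim x'" using that unfolding sim_def by auto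
    then show ?thesis by (simp add: rep_def)
  qed
  define Q where "Q = rep ` el A"
  define S where "S = {(B, fn f) | B f. sep B \<and> f \<in> hom X A B}"
  have "small Q" unfolding Q_def using small_image[OF small_el[OF A]] .
  moreover have "B \<in> Obj X \<and> \<phi> \<in> Q \<rightarrow> el B" if "(B, \<phi>) \<in> S" for B \<phi>
    using that sep_Obj fn_in rep unfolding S_def Q_def by auto
  ultimately obtain A' where A': "A' \<in> Obj X" "el A' = Q"
    and src: "\<And>B \<phi>. (B, \<phi>) \<in> S \<Longrightarrow> \<exists>g\<in>hom X A' B. \<forall>x\<in>Q. fn g x = \<phi> x"
    and lift: "\<And>Z h. \<lbrakk>Z \<in> Obj X; h \<in> el Z \<rightarrow> Q;
        \<And>B \<phi>. (B, \<phi>) \<in> S \<Longrightarrow> \<exists>k\<in>hom X Z B. \<forall>z\<in>el Z. fn k z = \<phi> (h z)\<rbrakk>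
      \<Longrightarrow> \<exists>h'\<in>hom X Z A'. \<forall>z\<in>el Z. fn h' z = h z"
    by (rule ex_initial_structure[of Q S]) auto
  have "\<exists>q\<in>hom X A A'. \<forall>x\<in>el A. fn q x = rep x"
    by (rule lift[OF A]) (auto simp: Q_def S_def fn_rep)
  then obtain q where q: "q \<in> hom X A A'" "\<And>x. x \<in> el A \<Longrightarrow> fn q x = rep x" by blast
  have factor: "\<exists>g\<in>hom X A' B. g \<cdot> q = f" if B: "sep B" and f: "f \<in> hom X A B" for B f
  proof -
    obtain g where g: "g \<in> hom X A' B" "\<And>x. x \<in> Q \<Longrightarrow> fn g x = fn f x"
      using src[of B "fn f"] B f unfolding S_def by blast
    have "g \<cdot> q = f"
      by (rule Comp_eqI[OF q(1) g(1) f]) (simp add: q(2) g(2) Q_def fn_rep[OF _ B f])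
    then show ?thesis using g(1) by blast
  qed
  have unique: "g = g'" if "g \<in> hom X A' B" "g' \<in> hom X A' B" "g \<cdot> q = g' \<cdot> q" for g g' B
  proof (rule hom_eqI[OF that(1,2)])
    fix y assume "y \<in> el A'"
    then obtain x where "x \<in> el A" "y = fn q x" using A'(2) q(2) unfolding Q_def by auto
    then show "fn g y = fn g' y"
      using fn_Comp[OF q(1) that(1)] fn_Comp[OF q(1) that(2)] that(3) by metis
  qed
  have "sep A'"
  proof (rule sepI[OF A'(1)])
    fix Y u v
    assume u: "u \<in> hom X Y A'" and v: "v \<in> hom X Y A'" and uv: "simeq le u v"
    show "u = v"
    proof (rule hom_eqI[OF u v])
      fix y assume y: "y \<in> el Y"
      obtain x x' where x: "x \<in> el A" "fn u y = rep x" "x' \<in> el A" "fn v y = rep x'"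
        using fn_in[OF u y] fn_in[OF v y] A'(2) unfolding Q_def by auto
      have "rep x = rep x'"
      proof (rule rep_eqI)
        fix B f assume B: "sep B" and f: "f \<in> hom X A B"
        obtain g where g: "g \<in> hom X A' B" "g \<cdot> q = f" using factor[OF B f] by blast
        have "g \<cdot> u = g \<cdot> v"
          using sepD[OF B Comp_in_hom[OF u g(1)] Comp_in_hom[OF v g(1)] simeq_Comp[OF u v uv g(1)]] .
        then have "fn g (fn u y) = fn g (fn v y)"
          using fn_Comp[OF u g(1) y] fn_Comp[OF v g(1) y] by simp
        then have "fn g (fn q x) = fn g (fn q x')" using x q(2) by simp
        then show "fn f x = fn f x'"
          using fn_Comp[OF q(1) g(1)] g(2) x by simp
      qed
      then show "fn u y = fn v y" using x by simp
    qed
  qed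
  moreover have "\<exists>!g. g \<in> hom X A' B \<and> g \<cdot> q = f" if "sep B" "f \<in> hom X A B" for B f
    using factor[OF that] unique by blast
  ultimately show ?thesis using q(1) by blast
qed

lemma hom_separated_subcategory:
  "hom (separated_subcategory X le) A B = (if sep A \<and> sep B then hom X A B else {})"
  unfolding separated_subcategory_def full_subcategory_def hom_def by auto

lemma separated_subcategory_simps:
  "Obj (separated_subcategory X le) = {A. sep A}"
  "Ide (separated_subcategory X le) = Ide X"
  "Comp (separated_subcategory X le) = Comp X"
  unfolding separated_subcategory_def full_subcategory_def by (auto simp: separated_def)

lemma ex_separated_reflector:
  obtains R \<eta> where "is_separated_reflector X le R"
    and "\<And>A. A \<in> Obj X \<Longrightarrow> sep (omap R A) \<and> \<eta> A \<in> hom X A (omap R A)"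
    and "\<And>A B f. f \<in> hom X A B \<Longrightarrow>
      amap R f \<in> hom X (omap R A) (omap R B) \<and> amap R f \<cdot> \<eta> A = \<eta> B \<cdot> f"
    and "\<And>A B f. \<lbrakk>A \<in> Obj X; sep B; f \<in> hom X A B\<rbrakk> \<Longrightarrow>
      \<exists>!g. g \<in> hom X (omap R A) B \<and> g \<cdot> \<eta> A = f"
proof -
  obtain F \<eta> where *: "\<And>A. A \<in> Obj X \<Longrightarrow> sep (F A) \<and> \<eta> A \<in> hom X A (F A) \<and>
      (\<forall>B f. sep B \<longrightarrow> f \<in> hom X A B \<longrightarrow> (\<exists>!g. g \<in> hom X (F A) B \<and> g \<cdot> \<eta> A = f))"
    using ex_separated_reflection by metis
  have F: "sep (F A)" and \<eta>: "\<eta> A \<in> hom X A (F A)"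
    and univ: "\<And>B f. \<lbrakk>sep B; f \<in> hom X A B\<rbrakk> \<Longrightarrow> \<exists>!g. g \<in> hom X (F A) B \<and> g \<cdot> \<eta> A = f"
    if "A \<in> Obj X" for A
    using *[OF that] by auto
  define fm where "fm f = (THE g. g \<in> hom X (F (Dom X f)) (F (Cod X f)) \<and>
      g \<cdot> \<eta> (Dom X f) = \<eta> (Cod X f) \<cdot> f)" for f
  have fm: "fm f \<in> hom X (F A) (F B) \<and> fm f \<cdot> \<eta> A = \<eta> B \<cdot> f" if f: "f \<in> hom X A B" for f A B
  proof -
    note O = hom_Obj[OF f]
    have D: "Dom X f = A" "Cod X f = B" using f by (auto simp: hom_def)
    show ?thesis unfolding fm_def D
      by (rule theI') (rule univ[OF O(1) F[OF O(2)] Comp_in_hom[OF f \<eta>[OF O(2)]]])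
  qed
  have eqI: "g = g'"
    if "A \<in> Obj X" "sep B" "g \<in> hom X (F A) B" "g' \<in> hom X (F A) B" "g \<cdot> \<eta> A = g' \<cdot> \<eta> A" for A B g g'
    using univ[OF that(1,2) Comp_in_hom[OF \<eta>[OF that(1)] that(4)]] that by blast
  define R where "R = \<lparr>omap = F, amap = fm\<rparr>"
  let ?D = "separated_subcategory X le"
  have "fm (Ide X A) = Ide X (F A)" if A: "A \<in> Obj X" for A
    using fm[OF Ide_in_hom[OF A]] Ide_Comp[OF \<eta>[OF A]] Comp_Ide[OF \<eta>[OF A]]
      Ide_in_hom[OF sep_Obj[OF F[OF A]]] by - (rule eqI[OF A F[OF A]], auto)
  moreover have "fm (g \<cdot> f) = fm g \<cdot> fm f" if f: "f \<in> hom X A B" and g: "g \<in> hom X B D" for A B D f g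
  proof (rule eqI)
    note O = hom_Obj[OF f] hom_Obj[OF g]
    show "A \<in> Obj X" "sep (F D)" using O F by auto
    show "fm (g \<cdot> f) \<in> hom X (F A) (F D)" using fm[OF Comp_in_hom[OF f g]] by blast
    show "fm g \<cdot> fm f \<in> hom X (F A) (F D)" using fm[OF f] fm[OF g] Comp_in_hom by blast
    have "(fm g \<cdot> fm f) \<cdot> \<eta> A = fm g \<cdot> (\<eta> B \<cdot> f)"
      using Comp_assoc[OF \<eta>[OF O(1)]] fm[OF f] fm[OF g] by auto
    also have "\<dots> = (\<eta> D \<cdot> g) \<cdot> f"
      using Comp_assoc[OF f \<eta>[OF O(2)], of "fm g" "F D"] fm[OF g] by simp
    also have "\<dots> = \<eta> D \<cdot> (g \<cdot> f)" using Comp_assoc[OF f g \<eta>[OF O(4)]] .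
    finally show "fm (g \<cdot> f) \<cdot> \<eta> A = (fm g \<cdot> fm f) \<cdot> \<eta> A"
      using fm[OF Comp_in_hom[OF f g]] by simp
  qed
  ultimately have "is_functor X ?D R"
    unfolding is_functor_def R_def separated_subcategory_simps hom_separated_subcategory
    using F fm by auto
  moreover have "is_functor ?D X inclusion"
    unfolding is_functor_def inclusion_def separated_subcategory_simps hom_separated_subcategory
    by (auto simp: sep_Obj)
  ultimately have "is_separated_reflector X le R"
    unfolding is_separated_reflector_def left_adjoint_def
    unfolding separated_subcategory_simps
  proof (intro conjI exI[of _ \<eta>])
    show "\<forall>A\<in>Obj X. \<eta> A \<in> hom X A (omap inclusion (omap R A))"
      using \<eta> by (simp add: R_def inclusion_def)
    show "\<forall>A\<in>Obj X. \<forall>B\<in>Obj X. \<forall>f\<in>hom X A B.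
        \<eta> B \<cdot> f = amap inclusion (amap R f) \<cdot> \<eta> A"
      using fm by (simp add: R_def inclusion_def)
    show "\<forall>A\<in>Obj X. \<forall>Y\<in>{A. sep A}. \<forall>f\<in>hom X A (omap inclusion Y).
        \<exists>!g. g \<in> hom ?D (omap R A) Y \<and> amap inclusion g \<cdot> \<eta> A = f"
      using univ F by (simp add: R_def inclusion_def hom_separated_subcategory)
  qed
  then show thesis
    by (rule that[of R \<eta>]) (simp_all add: R_def F \<eta> fm univ)
qed

section \<open>Exponentials of separated injective objects\<close>

definition evaluation :: "'o \<Rightarrow> 'o \<Rightarrow> 'o \<Rightarrow> 'm \<Rightarrow> bool"
  where "evaluation A Y E ev = is_exponential X (\<lambda>Z. prd Z A) (\<lambda>Z. pr1 Z A) (\<lambda>Z. pr2 Z A) Y E ev"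

lemma ex_evaluation:
  assumes "exponentiable X A" "Y \<in> Obj X"
  shows "\<exists>E ev. evaluation A Y E ev"
proof -
  have A: "A \<in> Obj X" using assms(1) by (simp add: exponentiable_def)
  interpret products_with X A "\<lambda>Z. prd Z A" "\<lambda>Z. pr1 Z A" "\<lambda>Z. pr2 Z A"
    using prd_product[OF _ A] by unfold_locales
  show ?thesis unfolding evaluation_def using exponentiableD[OF assms] .
qed

context
  fixes A Y E ev
  assumes A: "A \<in> Obj X" and E: "evaluation A Y E ev"
begin

lemma evaluation_Obj: "E \<in> Obj X"
  and evaluation_hom: "ev \<in> hom X (prd E A) Y"
  using E by (auto simp: evaluation_def is_exponential_def)

lemma ex_transpose:
  assumes "Z \<in> Obj X" "h \<in> hom X (prd Z A) Y"
  obtains k m where "k \<in> hom X Z E" "m \<in> hom X (prd Z A) (prd E A)"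
    "pr1 E A \<cdot> m = k \<cdot> pr1 Z A" "pr2 E A \<cdot> m = pr2 Z A" "ev \<cdot> m = h"
  using E assms unfolding evaluation_def is_exponential_def by blast

lemma times_ex:
  assumes k: "k \<in> hom X Z E"
  obtains m where "m \<in> hom X (prd Z A) (prd E A)"
    "pr1 E A \<cdot> m = k \<cdot> pr1 Z A" "pr2 E A \<cdot> m = pr2 Z A"
  using pair_ex[OF evaluation_Obj A Comp_in_hom[OF pr1_hom[OF hom_Obj(1)[OF k] A] k]
      pr2_hom[OF hom_Obj(1)[OF k] A]] .

lemma transpose_eqI:
  assumes k: "k \<in> hom X Z E" and k': "k' \<in> hom X Z E"
    and m: "m \<in> hom X (prd Z A) (prd E A)" "pr1 E A \<cdot> m = k \<cdot> pr1 Z A" "pr2 E A \<cdot> m = pr2 Z A"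
    and m': "m' \<in> hom X (prd Z A) (prd E A)" "pr1 E A \<cdot> m' = k' \<cdot> pr1 Z A" "pr2 E A \<cdot> m' = pr2 Z A"
    and eq: "ev \<cdot> m = ev \<cdot> m'"
  shows "k = k'"
proof -
  define transposes where "transposes l \<longleftrightarrow> l \<in> hom X Z E \<and> (\<exists>n\<in>hom X (prd Z A) (prd E A).
      pr1 E A \<cdot> n = l \<cdot> pr1 Z A \<and> pr2 E A \<cdot> n = pr2 Z A \<and> ev \<cdot> n = ev \<cdot> m)" for l
  have "\<exists>!l. transposes l"
    using E hom_Obj(1)[OF k] Comp_in_hom[OF m(1) evaluation_hom]
    unfolding evaluation_def is_exponential_def transposes_def by blast
  moreover have "transposes k" unfolding transposes_def using k m by blast
  moreover have "transposes k'" unfolding transposes_def using k' m' eq[symmetric] by blast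
  ultimately show ?thesis by blast
qed

text \<open>
  A morphism into \<open>E\<close> extends along an initial morphism \<open>y\<close> because its transpose extends along
  \<open>y \<times> A\<close>, which is again initial.
\<close>

lemma inj_obj_exponential:
  assumes Y: "sep Y" "inj_obj Y"
  shows "inj_obj E"
proof (rule inj_objI[OF evaluation_Obj])
  fix B D y f
  assume y: "initial_morphism X (Sets small) U B D y" "y \<in> hom X B D" and f: "f \<in> hom X B E"
  note O = hom_Obj[OF y(2)]
  note p = pr1_hom[OF _ A] and q = pr2_hom[OF _ A]
  obtain n where n: "n \<in> hom X (prd B A) (prd E A)" "pr1 E A \<cdot> n = f \<cdot> pr1 B A" "pr2 E A \<cdot> n = pr2 B A"
    using times_ex[OF f] .
  obtain w where w: "w \<in> hom X (prd B A) (prd D A)" "pr1 D A \<cdot> w = y \<cdot> pr1 B A" "pr2 D A \<cdot> w = pr2 B A"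
    using pair_ex[OF O(2) A Comp_in_hom[OF p[OF O(1)] y(2)] q[OF O(1)]] .
  have "initial_morphism X (Sets small) U (prd B A) (prd D A) w"
  proof (rule initial_morphismI[OF w(1)])
    fix Z h k
    assume h: "h \<in> el Z \<rightarrow> el (prd B A)" and k: "k \<in> hom X Z (prd D A)"
      and hk: "\<And>z. z \<in> el Z \<Longrightarrow> fn w (h z) = fn k z"
    have hz: "h z \<in> el (prd B A)" if "z \<in> el Z" for z using h that by blast
    have "\<exists>u\<in>hom X Z B. \<forall>z\<in>el Z. fn u z = fn (pr1 B A) (h z)"
    proof (rule initial_morphismD[OF y(1) _ Comp_in_hom[OF k p[OF O(2)]]])
      show "(\<lambda>z. fn (pr1 B A) (h z)) \<in> el Z \<rightarrow> el B" using fn_in[OF p[OF O(1)] hz] by blast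
      fix z assume z: "z \<in> el Z"
      show "fn y (fn (pr1 B A) (h z)) = fn (pr1 D A \<cdot> k) z"
        using Comp_eqD[OF w(2) w(1) p[OF O(2)] hz[OF z]] fn_Comp[OF p[OF O(1)] y(2) hz[OF z]]
          fn_Comp[OF k p[OF O(2)] z] hk[OF z] by simp
    qed
    then obtain u where u: "u \<in> hom X Z B" "\<And>z. z \<in> el Z \<Longrightarrow> fn u z = fn (pr1 B A) (h z)" by blast
    obtain h' where h': "h' \<in> hom X Z (prd B A)" "pr1 B A \<cdot> h' = u" "pr2 B A \<cdot> h' = pr2 D A \<cdot> k"
      using pair_ex[OF O(1) A u(1) Comp_in_hom[OF k q[OF O(2)]]] .
    have "fn h' z = h z" if z: "z \<in> el Z" for z
    proof (rule prd_el_eqI[OF O(1) A fn_in[OF h'(1) z] hz[OF z]])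
      show "fn (pr1 B A) (fn h' z) = fn (pr1 B A) (h z)"
        using Comp_eqD[OF h'(2) h'(1) p[OF O(1)] z] u(2)[OF z] by simp
      show "fn (pr2 B A) (fn h' z) = fn (pr2 B A) (h z)"
        using Comp_eqD[OF h'(3) h'(1) q[OF O(1)] z] fn_Comp[OF k q[OF O(2)] z] hk[OF z]
          Comp_eqD[OF w(3) w(1) q[OF O(2)] hz[OF z]] by simp
    qed
    then show "\<exists>h'\<in>hom X Z (prd B A). \<forall>z\<in>el Z. fn h' z = h z" using h'(1) by blast
  qed
  from sep_inj_extend[OF Y this Comp_in_hom[OF n(1) evaluation_hom]]
  obtain g where g: "g \<in> hom X (prd D A) Y" "g \<cdot> w = ev \<cdot> n" .
  obtain k m where k: "k \<in> hom X D E" and m: "m \<in> hom X (prd D A) (prd E A)"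
    "pr1 E A \<cdot> m = k \<cdot> pr1 D A" "pr2 E A \<cdot> m = pr2 D A" "ev \<cdot> m = g"
    using ex_transpose[OF O(2) g(1)] .
  note PE = p[OF evaluation_Obj] q[OF evaluation_Obj]
  have "k \<cdot> y = f"
  proof (rule transpose_eqI[OF Comp_in_hom[OF y(2) k] f Comp_in_hom[OF w(1) m(1)] _ _ n])
    show "pr1 E A \<cdot> (m \<cdot> w) = (k \<cdot> y) \<cdot> pr1 B A"
      using Comp_assoc[OF w(1) m(1) PE(1)] m(2) Comp_assoc[OF w(1) p[OF O(2)] k] w(2)
        Comp_assoc[OF p[OF O(1)] y(2) k] by simp
    show "pr2 E A \<cdot> (m \<cdot> w) = pr2 B A"
      using Comp_assoc[OF w(1) m(1) PE(2)] m(3) w(3) by simp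
    show "ev \<cdot> (m \<cdot> w) = ev \<cdot> n"
      using Comp_assoc[OF w(1) m(1) evaluation_hom] m(4) g(2) by simp
  qed
  then show "\<exists>f'\<in>hom X D E. f' \<cdot> y = f" using k by blast
qed

text \<open>
  As \<open>R\<close> preserves the product \<open>E \<times> A\<close>, the evaluation, which factors through \<open>R (E \<times> A)\<close> since \<open>Y\<close>
  is separated, induces a morphism \<open>R E \<times> A \<rightarrow> Y\<close>. Its transpose is a retraction of the reflection
  \<open>E \<rightarrow> R E\<close>. Hence \<open>E\<close>, being a retract of a separated object, is separated.
\<close>

lemma sep_exponential:
  assumes Y: "sep Y" and sA: "sep A"
    and preserves: "\<And>R. is_separated_reflector X le R \<Longrightarrow>
      preserves_finite_products X (separated_subcategory X le) R"
  shows "sep E"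
proof -
  obtain R \<eta> where R: "is_separated_reflector X le R"
    and \<eta>: "\<And>A. A \<in> Obj X \<Longrightarrow> sep (omap R A) \<and> \<eta> A \<in> hom X A (omap R A)"
    and nat: "\<And>A B f. f \<in> hom X A B \<Longrightarrow>
      amap R f \<in> hom X (omap R A) (omap R B) \<and> amap R f \<cdot> \<eta> A = \<eta> B \<cdot> f"
    and univ: "\<And>A B f. \<lbrakk>A \<in> Obj X; sep B; f \<in> hom X A B\<rbrakk> \<Longrightarrow>
      \<exists>!g. g \<in> hom X (omap R A) B \<and> g \<cdot> \<eta> A = f"
    by (rule ex_separated_reflector) (rule that; blast)
  have R_eqI: "g = g'"
    if "A \<in> Obj X" "sep B" "g \<in> hom X (omap R A) B" "g' \<in> hom X (omap R A) B" "g \<cdot> \<eta> A = g' \<cdot> \<eta> A"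
    for A B g g'
    using univ[OF that(1,2) Comp_in_hom[OF conjunct2[OF \<eta>[OF that(1)]] that(4)]] that by blast
  let ?P = "prd E A" and ?p = "pr1 E A" and ?q = "pr2 E A"
  note EO = evaluation_Obj
  note p = pr1_hom[OF EO A] and q = pr2_hom[OF EO A] and PO = prd_Obj[OF EO A]
  have RE: "sep (omap R E)" "\<eta> E \<in> hom X E (omap R E)"
    and RA: "sep (omap R A)" "\<eta> A \<in> hom X A (omap R A)"
    and RP: "sep (omap R ?P)" "\<eta> ?P \<in> hom X ?P (omap R ?P)"
    using \<eta> EO A PO by auto
  note REO = sep_Obj[OF RE(1)]
  have Rp: "amap R ?p \<in> hom X (omap R ?P) (omap R E)" "amap R ?p \<cdot> \<eta> ?P = \<eta> E \<cdot> ?p"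
    and Rq: "amap R ?q \<in> hom X (omap R ?P) (omap R A)" "amap R ?q \<cdot> \<eta> ?P = \<eta> A \<cdot> ?q"
    using nat[OF p] nat[OF q] by auto
  have "is_product (separated_subcategory X le) (omap R E) (omap R A) (omap R ?P) (amap R ?p) (amap R ?q)"
    using preserves[OF R] prd_product[OF EO A] EO A unfolding preserves_finite_products_def by blast
  then have prod: "\<exists>!h. h \<in> hom X Z (omap R ?P) \<and> amap R ?p \<cdot> h = f \<and> amap R ?q \<cdot> h = g"
    if "sep Z" "f \<in> hom X Z (omap R E)" "g \<in> hom X Z (omap R A)" for Z f g
    using that RE(1) RA(1) RP(1)
    unfolding is_product_def separated_subcategory_simps hom_separated_subcategory by simp
  obtain e where e: "e \<in> hom X (omap R ?P) Y" "e \<cdot> \<eta> ?P = ev"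
    using univ[OF PO Y evaluation_hom] by blast
  let ?Q = "prd (omap R E) A" and ?p' = "pr1 (omap R E) A" and ?q' = "pr2 (omap R E) A"
  note p' = pr1_hom[OF REO A] and q' = pr2_hom[OF REO A]
  obtain t where t: "t \<in> hom X ?Q (omap R ?P)" "amap R ?p \<cdot> t = ?p'" "amap R ?q \<cdot> t = \<eta> A \<cdot> ?q'"
    using prod[OF sep_prd[OF RE(1) sA] p' Comp_in_hom[OF q' RA(2)]] by blast
  obtain r m where r: "r \<in> hom X (omap R E) E" and m: "m \<in> hom X ?Q ?P"
    "?p \<cdot> m = r \<cdot> ?p'" "?q \<cdot> m = ?q'" "ev \<cdot> m = e \<cdot> t"
    using ex_transpose[OF REO Comp_in_hom[OF t(1) e(1)]] .
  obtain n where n: "n \<in> hom X ?P ?Q" "?p' \<cdot> n = \<eta> E \<cdot> ?p" "?q' \<cdot> n = ?q"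
    using pair_ex[OF REO A Comp_in_hom[OF p RE(2)] q] .
  have tn: "t \<cdot> n = \<eta> ?P"
  proof -
    note tn = Comp_in_hom[OF n(1) t(1)]
    obtain u where u: "u \<in> hom X (omap R ?P) (omap R ?P)" "u \<cdot> \<eta> ?P = t \<cdot> n"
      using univ[OF PO RP(1) tn] by blast
    have "amap R ?p \<cdot> u = amap R ?p"
    proof (rule R_eqI[OF PO RE(1) Comp_in_hom[OF u(1) Rp(1)] Rp(1)])
      show "(amap R ?p \<cdot> u) \<cdot> \<eta> ?P = amap R ?p \<cdot> \<eta> ?P"
        using Comp_assoc[OF RP(2) u(1) Rp(1)] u(2) Comp_assoc[OF n(1) t(1) Rp(1)] t(2) n(2) Rp(2)
        by simp
    qed
    moreover have "amap R ?q \<cdot> u = amap R ?q"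
    proof (rule R_eqI[OF PO RA(1) Comp_in_hom[OF u(1) Rq(1)] Rq(1)])
      show "(amap R ?q \<cdot> u) \<cdot> \<eta> ?P = amap R ?q \<cdot> \<eta> ?P"
        using Comp_assoc[OF RP(2) u(1) Rq(1)] u(2) Comp_assoc[OF n(1) t(1) Rq(1)] t(3) n(3) Rq(2)
          Comp_assoc[OF n(1) q' RA(2)] by simp
    qed
    moreover have "amap R ?p \<cdot> Ide X (omap R ?P) = amap R ?p" "amap R ?q \<cdot> Ide X (omap R ?P) = amap R ?q"
      using Comp_Ide Rp(1) Rq(1) by auto
    ultimately have "u = Ide X (omap R ?P)"
      using prod[OF RP(1) Rp(1) Rq(1)] u(1) Ide_in_hom[OF sep_Obj[OF RP(1)]] by blast
    then show ?thesis using u(2) Ide_Comp[OF RP(2)] by simp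
  qed
  have "r \<cdot> \<eta> E = Ide X E"
  proof (rule transpose_eqI[OF Comp_in_hom[OF RE(2) r] Ide_in_hom[OF EO] Comp_in_hom[OF n(1) m(1)]
        _ _ Ide_in_hom[OF PO]])
    show "?p \<cdot> (m \<cdot> n) = (r \<cdot> \<eta> E) \<cdot> ?p"
      using Comp_assoc[OF n(1) m(1) p] m(2) Comp_assoc[OF n(1) p' r] n(2) Comp_assoc[OF p RE(2) r]
      by simp
    show "?q \<cdot> (m \<cdot> n) = ?q" using Comp_assoc[OF n(1) m(1) q] m(3) n(3) by simp
    show "?p \<cdot> Ide X ?P = Ide X E \<cdot> ?p" using Comp_Ide[OF p] Ide_Comp[OF p] by simp
    show "?q \<cdot> Ide X ?P = ?q" using Comp_Ide[OF q] .
    show "ev \<cdot> (m \<cdot> n) = ev \<cdot> Ide X ?P"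
      using Comp_assoc[OF n(1) m(1) evaluation_hom] m(4) Comp_assoc[OF n(1) t(1) e(1)] tn e(2)
        Comp_Ide[OF evaluation_hom] by simp
  qed
  then have retract: "r \<cdot> (\<eta> E \<cdot> f) = f" if "f \<in> hom X Z E" for f Z
    using Comp_assoc[OF that RE(2) r] Ide_Comp[OF that] by simp
  show ?thesis
  proof (rule sepI[OF EO])
    fix Z f g
    assume f: "f \<in> hom X Z E" and g: "g \<in> hom X Z E" and fg: "simeq le f g"
    have "\<eta> E \<cdot> f = \<eta> E \<cdot> g"
      using sepD[OF RE(1) Comp_in_hom[OF f RE(2)] Comp_in_hom[OF g RE(2)] simeq_Comp[OF f g fg RE(2)]] .
    then show "f = g" using retract[OF f] retract[OF g] by metis
  qed
qed

end

end


section \<open>Partial equivalence relations on separated injective objects\<close>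

context ordered_topological
begin

abbreviation PE :: "(('o, 'u) per_object, (('o, 'u) per_object, 'm set) arrow) category"
  where "PE \<equiv> PEqu_sep small X U le"

abbreviation pobj :: "('o, 'u) per_object set"
  where "pobj \<equiv> PEqu_objects small X U le"

abbreviation eqv :: "('o, 'u) per_object \<Rightarrow> ('o, 'u) per_object \<Rightarrow> 'm set"
  where "eqv \<equiv> equivariant X U"

abbreviation rel :: "('o, 'u) per_object \<Rightarrow> ('o, 'u) per_object \<Rightarrow> ('m \<times> 'm) set"
  where "rel \<equiv> PEqu_rel X U"

definition cls ::
    "('o, 'u) per_object \<Rightarrow> ('o, 'u) per_object \<Rightarrow> 'm \<Rightarrow> (('o, 'u) per_object, 'm set) arrow"
  where "cls P Q f = Arrow P (rel P Q `` {f}) Q"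

lemma pobjD:
  assumes "P \<in> pobj"
  shows "sep (fst P)" "inj_obj (fst P)" "fst P \<in> Obj X" "sym (snd P)" "trans (snd P)"
    and "(x, y) \<in> snd P \<Longrightarrow> x \<in> el (fst P) \<and> y \<in> el (fst P)"
  using assms sep_Obj by (auto simp: PEqu_objects_def)

lemma per_refl:
  assumes "P \<in> pobj" "(x, y) \<in> snd P"
  shows "(x, x) \<in> snd P" "(y, y) \<in> snd P" "(y, x) \<in> snd P"
  using pobjD(4,5)[OF assms(1)] assms(2) by (meson symD transD)+

lemma eqvI:
  assumes "f \<in> hom X (fst P) (fst Q)" "\<And>x x'. (x, x') \<in> snd P \<Longrightarrow> (fn f x, fn f x') \<in> snd Q"
  shows "f \<in> eqv P Q"
  using assms by (auto simp: equivariant_def)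

lemma eqvD:
  assumes "f \<in> eqv P Q"
  shows "f \<in> hom X (fst P) (fst Q)" "(x, x') \<in> snd P \<Longrightarrow> (fn f x, fn f x') \<in> snd Q"
  using assms by (auto simp: equivariant_def)

lemma rel_iff:
  "(f, g) \<in> rel P Q \<longleftrightarrow> f \<in> eqv P Q \<and> g \<in> eqv P Q \<and>
    (\<forall>x x'. (x, x') \<in> snd P \<longrightarrow> (fn f x, fn g x') \<in> snd Q)"
  by (auto simp: PEqu_rel_def)

lemma equiv_rel:
  assumes P: "P \<in> pobj" and Q: "Q \<in> pobj"
  shows "equiv (eqv P Q) (rel P Q)"
proof (rule equivI)
  show "rel P Q \<subseteq> eqv P Q \<times> eqv P Q" by (auto simp: rel_iff)
  show "refl_on (eqv P Q) (rel P Q)" by (auto simp: refl_on_def rel_iff dest: eqvD)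
  show "sym (rel P Q)"
    using per_refl(3)[OF P] per_refl(3)[OF Q] by (auto intro!: symI simp: rel_iff)
  show "trans (rel P Q)"
    using per_refl(1)[OF P] pobjD(5)[OF Q] unfolding trans_def by (simp add: rel_iff) blast
qed

lemma cls_eq_iff:
  assumes "P \<in> pobj" "Q \<in> pobj" "f \<in> eqv P Q" "g \<in> eqv P Q"
  shows "cls P Q f = cls P Q g \<longleftrightarrow> (f, g) \<in> rel P Q"
  unfolding cls_def using eq_equiv_class_iff[OF equiv_rel[OF assms(1,2)] assms(3,4)] by simp

lemma cls_eqI:
  assumes "P \<in> pobj" "Q \<in> pobj" "f \<in> eqv P Q" "g \<in> eqv P Q"
    and "\<And>x x'. (x, x') \<in> snd P \<Longrightarrow> (fn f x, fn g x') \<in> snd Q"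
  shows "cls P Q f = cls P Q g"
  using assms by (simp add: cls_eq_iff rel_iff)

lemma cls_eqD:
  assumes "cls P Q f = cls P Q g" "P \<in> pobj" "Q \<in> pobj" "f \<in> eqv P Q" "g \<in> eqv P Q"
    and "(x, x') \<in> snd P"
  shows "(fn f x, fn g x') \<in> snd Q"
  using assms by (simp add: cls_eq_iff rel_iff)

lemma hom_PE:
  "F \<in> hom PE P Q \<longleftrightarrow> P \<in> pobj \<and> Q \<in> pobj \<and> (\<exists>f\<in>eqv P Q. F = cls P Q f)"
  unfolding hom_def PEqu_sep_def cls_def quotient_def by (auto simp del: split_paired_Ex)

lemma Obj_PE: "Obj PE = pobj"
  by (simp add: PEqu_sep_def)

lemma cls_hom: "\<lbrakk>P \<in> pobj; Q \<in> pobj; f \<in> eqv P Q\<rbrakk> \<Longrightarrow> cls P Q f \<in> hom PE P Q"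
  by (auto simp: hom_PE)

lemma hom_PE_cls:
  assumes "F \<in> hom PE P Q"
  obtains f where "P \<in> pobj" "Q \<in> pobj" "f \<in> eqv P Q" "F = cls P Q f"
  using assms by (auto simp: hom_PE)

lemma eqv_Comp:
  assumes "P \<in> pobj" and f: "f \<in> eqv P Q" and g: "g \<in> eqv Q R"
  shows "g \<cdot> f \<in> eqv P R"
proof (rule eqvI)
  show "g \<cdot> f \<in> hom X (fst P) (fst R)" using Comp_in_hom[OF eqvD(1)[OF f] eqvD(1)[OF g]] .
  fix x x' assume x: "(x, x') \<in> snd P"
  show "(fn (g \<cdot> f) x, fn (g \<cdot> f) x') \<in> snd R"
    using eqvD(2)[OF g eqvD(2)[OF f x]] fn_Comp[OF eqvD(1)[OF f] eqvD(1)[OF g]]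
      pobjD(6)[OF assms(1) x] by simp
qed

lemma eqv_Ide:
  assumes "P \<in> pobj"
  shows "Ide X (fst P) \<in> eqv P P"
  using Ide_in_hom[OF pobjD(3)[OF assms]] pobjD(3,6)[OF assms] fn_Ide by (intro eqvI) auto

lemma rel_Comp:
  assumes P: "P \<in> pobj" and f: "(f, f') \<in> rel P Q" and g: "(g, g') \<in> rel Q R"
  shows "(g \<cdot> f, g' \<cdot> f') \<in> rel P R"
proof -
  have m: "f \<in> eqv P Q" "f' \<in> eqv P Q" "g \<in> eqv Q R" "g' \<in> eqv Q R"
    using f g by (auto simp: rel_iff)
  have "(fn (g \<cdot> f) x, fn (g' \<cdot> f') x') \<in> snd R" if x: "(x, x') \<in> snd P" for x x'
    using fn_Comp[OF eqvD(1)[OF m(1)] eqvD(1)[OF m(3)]]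
      fn_Comp[OF eqvD(1)[OF m(2)] eqvD(1)[OF m(4)]] pobjD(6)[OF P x] f g x
    by (simp add: rel_iff)
  then show ?thesis using eqv_Comp[OF P] m by (simp add: rel_iff)
qed

lemma cls_Comp:
  assumes P: "P \<in> pobj" and Q: "Q \<in> pobj" and R: "R \<in> pobj"
    and f: "f \<in> eqv P Q" and g: "g \<in> eqv Q R"
  shows "cls Q R g \<cdot>\<^bsub>PE\<^esub> cls P Q f = cls P R (g \<cdot> f)"
proof -
  have "rel P R `` {g' \<cdot> f'} = rel P R `` {g \<cdot> f}"
    if "g' \<in> rel Q R `` {g}" "f' \<in> rel P Q `` {f}" for g' f'
    using equiv_class_eq[OF equiv_rel[OF P R] rel_Comp[OF P, of f f' Q g g' R]] that by simp
  moreover have "g \<in> rel Q R `` {g}" "f \<in> rel P Q `` {f}"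
    using equiv_class_self[OF equiv_rel] P Q R f g by auto
  ultimately have "(\<Union>g'\<in>rel Q R `` {g}. \<Union>f'\<in>rel P Q `` {f}. rel P R `` {g' \<cdot> f'}) = rel P R `` {g \<cdot> f}"
    by blast
  then show ?thesis by (simp add: PEqu_sep_def cls_def)
qed

text \<open>
  All laws are inherited from \<open>X\<close>, since composition of classes is composition of representatives.
\<close>

lemma category_PE: "category PE"
proof
  fix F assume "F \<in> Arr PE"
  then show "Dom PE F \<in> Obj PE" "Cod PE F \<in> Obj PE" by (auto simp: PEqu_sep_def)
next
  fix A assume A: "A \<in> Obj PE"
  have "Ide PE A = cls A A (Ide X (fst A))" by (simp add: PEqu_sep_def cls_def)
  then show "Ide PE A \<in> hom PE A A" using A eqv_Ide[of A] cls_hom[of A A] by (simp add: Obj_PE)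
next
  fix A B D F G assume "F \<in> hom PE A B" "G \<in> hom PE B D"
  then show "G \<cdot>\<^bsub>PE\<^esub> F \<in> hom PE A D"
    by (elim hom_PE_cls) (auto simp: cls_Comp hom_PE intro!: eqv_Comp)
next
  fix A B F assume "F \<in> hom PE A B"
  then obtain f where f: "A \<in> pobj" "B \<in> pobj" "f \<in> eqv A B" "F = cls A B f" by (rule hom_PE_cls)
  have "Ide PE A = cls A A (Ide X (fst A))" "Ide PE B = cls B B (Ide X (fst B))"
    by (simp_all add: PEqu_sep_def cls_def)
  then show "F \<cdot>\<^bsub>PE\<^esub> Ide PE A = F" "Ide PE B \<cdot>\<^bsub>PE\<^esub> F = F"
    using f eqv_Ide Comp_Ide[OF eqvD(1)[OF f(3)]] Ide_Comp[OF eqvD(1)[OF f(3)]]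
    by (simp_all add: cls_Comp)
next
  fix A B D E F G H
  assume "F \<in> hom PE A B" "G \<in> hom PE B D" "H \<in> hom PE D E"
  then obtain f g h where fgh: "f \<in> eqv A B" "g \<in> eqv B D" "h \<in> eqv D E"
    and FGH: "F = cls A B f" "G = cls B D g" "H = cls D E h"
    and O: "A \<in> pobj" "B \<in> pobj" "D \<in> pobj" "E \<in> pobj"
    by (elim hom_PE_cls) blast
  show "H \<cdot>\<^bsub>PE\<^esub> G \<cdot>\<^bsub>PE\<^esub> F = H \<cdot>\<^bsub>PE\<^esub> (G \<cdot>\<^bsub>PE\<^esub> F)"
    using Comp_assoc[OF eqvD(1)[OF fgh(1)] eqvD(1)[OF fgh(2)] eqvD(1)[OF fgh(3)]]
    by (simp add: FGH O fgh cls_Comp eqv_Comp[OF O(1) fgh(1,2)] eqv_Comp[OF O(2) fgh(2,3)])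
qed

subsection \<open>Products of partial equivalence relations\<close>

definition pprd :: "('o, 'u) per_object \<Rightarrow> ('o, 'u) per_object \<Rightarrow> ('o, 'u) per_object"
  where "pprd P Q = (prd (fst P) (fst Q),
    {(z, z'). z \<in> el (prd (fst P) (fst Q)) \<and> z' \<in> el (prd (fst P) (fst Q)) \<and>
      (fn (pr1 (fst P) (fst Q)) z, fn (pr1 (fst P) (fst Q)) z') \<in> snd P \<and>
      (fn (pr2 (fst P) (fst Q)) z, fn (pr2 (fst P) (fst Q)) z') \<in> snd Q})"

definition ppr1 :: "('o, 'u) per_object \<Rightarrow> ('o, 'u) per_object \<Rightarrow> (('o, 'u) per_object, 'm set) arrow"
  where "ppr1 P Q = cls (pprd P Q) P (pr1 (fst P) (fst Q))"

definition ppr2 :: "('o, 'u) per_object \<Rightarrow> ('o, 'u) per_object \<Rightarrow> (('o, 'u) per_object, 'm set) arrow"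
  where "ppr2 P Q = cls (pprd P Q) Q (pr2 (fst P) (fst Q))"

context
  fixes P Q
  assumes P: "P \<in> pobj" and Q: "Q \<in> pobj"
begin

lemma fst_pprd: "fst (pprd P Q) = prd (fst P) (fst Q)"
  by (simp add: pprd_def)

lemma pprd_iff:
  "(z, z') \<in> snd (pprd P Q) \<longleftrightarrow> z \<in> el (prd (fst P) (fst Q)) \<and> z' \<in> el (prd (fst P) (fst Q)) \<and>
      (fn (pr1 (fst P) (fst Q)) z, fn (pr1 (fst P) (fst Q)) z') \<in> snd P \<and>
      (fn (pr2 (fst P) (fst Q)) z, fn (pr2 (fst P) (fst Q)) z') \<in> snd Q"
  by (simp add: pprd_def)

lemma pprd_pobj: "pprd P Q \<in> pobj"
proof -
  have "sep (fst (pprd P Q))" "inj_obj (fst (pprd P Q))"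
    unfolding fst_pprd using sep_prd inj_obj_prd pobjD(1,2) P Q by auto
  moreover have "snd (pprd P Q) \<subseteq> el (fst (pprd P Q)) \<times> el (fst (pprd P Q))"
    unfolding fst_pprd by (auto simp: pprd_iff)
  moreover have "sym (snd (pprd P Q))"
    using per_refl(3)[OF P] per_refl(3)[OF Q] by (auto intro!: symI simp: pprd_iff)
  moreover have "trans (snd (pprd P Q))"
    using pobjD(5)[OF P] pobjD(5)[OF Q] by (auto intro!: transI simp: pprd_iff dest: transD)
  ultimately show ?thesis by (auto simp: PEqu_objects_def case_prod_beta)
qed

lemma pr1_eqv: "pr1 (fst P) (fst Q) \<in> eqv (pprd P Q) P"
  and pr2_eqv: "pr2 (fst P) (fst Q) \<in> eqv (pprd P Q) Q"
  using pr1_hom[OF pobjD(3)[OF P] pobjD(3)[OF Q]] pr2_hom[OF pobjD(3)[OF P] pobjD(3)[OF Q]]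
  by (auto intro!: eqvI simp: fst_pprd pprd_iff)

text \<open>
  The relation on the product is detected by the projections. Hence representatives whose composites
  with the projections are related are related themselves, which makes pairings of classes unique.
\<close>

lemma rel_pprdI:
  assumes Z: "Z \<in> pobj" and m: "m \<in> hom X (fst Z) (prd (fst P) (fst Q))" "m' \<in> hom X (fst Z) (prd (fst P) (fst Q))"
    and x: "(x, x') \<in> snd Z"
    and "(fn (pr1 (fst P) (fst Q) \<cdot> m) x, fn (pr1 (fst P) (fst Q) \<cdot> m') x') \<in> snd P"
    and "(fn (pr2 (fst P) (fst Q) \<cdot> m) x, fn (pr2 (fst P) (fst Q) \<cdot> m') x') \<in> snd Q"
  shows "(fn m x, fn m' x') \<in> snd (pprd P Q)"
proof -
  note O = pobjD(3)[OF P] pobjD(3)[OF Q]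
  have "x \<in> el (fst Z)" "x' \<in> el (fst Z)" using pobjD(6)[OF Z x] by auto
  then show ?thesis
    using assms(5,6) fn_Comp[OF m(1) pr1_hom[OF O]] fn_Comp[OF m(2) pr1_hom[OF O]]
      fn_Comp[OF m(1) pr2_hom[OF O]] fn_Comp[OF m(2) pr2_hom[OF O]] fn_in[OF m(1)] fn_in[OF m(2)]
    by (simp add: pprd_iff)
qed

lemma pprd_product: "is_product PE P Q (pprd P Q) (ppr1 P Q) (ppr2 P Q)"
  unfolding is_product_def
proof (intro conjI ballI)
  note O = pobjD(3)[OF P] pobjD(3)[OF Q]
  let ?p = "pr1 (fst P) (fst Q)" and ?q = "pr2 (fst P) (fst Q)"
  show "pprd P Q \<in> Obj PE" using pprd_pobj by (simp add: Obj_PE)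
  show "ppr1 P Q \<in> hom PE (pprd P Q) P" "ppr2 P Q \<in> hom PE (pprd P Q) Q"
    unfolding ppr1_def ppr2_def using cls_hom pprd_pobj P Q pr1_eqv pr2_eqv by auto
  fix Z F G
  assume "F \<in> hom PE Z P" "G \<in> hom PE Z Q"
  then obtain f g where Z: "Z \<in> pobj" and f: "f \<in> eqv Z P" "F = cls Z P f"
    and g: "g \<in> eqv Z Q" "G = cls Z Q g"
    by (elim hom_PE_cls) blast
  obtain m where m: "m \<in> hom X (fst Z) (prd (fst P) (fst Q))" "?p \<cdot> m = f" "?q \<cdot> m = g"
    using pair_ex[OF O eqvD(1)[OF f(1)] eqvD(1)[OF g(1)]] .
  have me: "m \<in> eqv Z (pprd P Q)"
    using m(1) eqvD(2)[OF f(1)] eqvD(2)[OF g(1)]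
    by (intro eqvI) (auto simp: fst_pprd m(2,3) intro!: rel_pprdI[OF Z m(1) m(1)])
  show "\<exists>!M. M \<in> hom PE Z (pprd P Q) \<and> ppr1 P Q \<cdot>\<^bsub>PE\<^esub> M = F \<and> ppr2 P Q \<cdot>\<^bsub>PE\<^esub> M = G"
  proof (rule ex1I)
    show "cls Z (pprd P Q) m \<in> hom PE Z (pprd P Q) \<and> ppr1 P Q \<cdot>\<^bsub>PE\<^esub> cls Z (pprd P Q) m = F \<and>
        ppr2 P Q \<cdot>\<^bsub>PE\<^esub> cls Z (pprd P Q) m = G"
      unfolding ppr1_def ppr2_def
      by (simp add: cls_hom cls_Comp Z P Q pprd_pobj me pr1_eqv pr2_eqv m f g)
  next
    fix M assume M: "M \<in> hom PE Z (pprd P Q) \<and> ppr1 P Q \<cdot>\<^bsub>PE\<^esub> M = F \<and> ppr2 P Q \<cdot>\<^bsub>PE\<^esub> M = G"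
    then obtain n where n: "n \<in> eqv Z (pprd P Q)" "M = cls Z (pprd P Q) n" by (auto elim: hom_PE_cls)
    have pn: "?p \<cdot> n \<in> eqv Z P" "?q \<cdot> n \<in> eqv Z Q"
      using eqv_Comp[OF Z n(1)] pr1_eqv pr2_eqv by auto
    have "cls Z P (?p \<cdot> n) = cls Z P f" "cls Z Q (?q \<cdot> n) = cls Z Q g"
      using M unfolding ppr1_def ppr2_def n(2) f(2) g(2)
      by (simp_all add: cls_Comp Z P Q pprd_pobj n(1) pr1_eqv pr2_eqv)
    then have "(fn n x, fn m x') \<in> snd (pprd P Q)" if "(x, x') \<in> snd Z" for x x'
      using rel_pprdI[OF Z _ m(1) that] eqvD(1)[OF n(1)] m(2,3) that
        cls_eqD[of Z P "?p \<cdot> n" f x x'] cls_eqD[of Z Q "?q \<cdot> n" g x x'] Z P Q pn f(1) g(1)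
      by (simp add: fst_pprd)
    then show "M = cls Z (pprd P Q) m"
      unfolding n(2) by (intro cls_eqI Z pprd_pobj n(1) me)
  qed
qed

end

subsection \<open>Terminal object and exponentials\<close>

lemma ex_terminal_PE: "\<exists>T. is_terminal PE T"
proof -
  obtain T t where T: "sep T" "inj_obj T" "el T = {t}" and ex: "\<And>Z. Z \<in> Obj X \<Longrightarrow> \<exists>f. f \<in> hom X Z T"
    by (rule ex_sep_inj_terminal) (rule that; blast)
  let ?T = "(T, {(t, t)})"
  have Tp: "?T \<in> pobj"
    using T by (auto simp: PEqu_objects_def sym_def trans_def)
  have fn_T: "fn f x = t" if "f \<in> hom X Z T" "x \<in> el Z" for f x Z
    using fn_in[OF that] T(3) by auto
  have "\<exists>!F. F \<in> hom PE P ?T" if P: "P \<in> pobj" for P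
  proof -
    have e: "f \<in> eqv P ?T \<longleftrightarrow> f \<in> hom X (fst P) T" for f
      using eqvD(1)[of f P ?T] fn_T pobjD(6)[OF P] by (auto intro: eqvI)
    obtain f where f: "f \<in> eqv P ?T" using ex[OF pobjD(3)[OF P]] e by blast
    have "cls P ?T g = cls P ?T f" if "g \<in> eqv P ?T" for g
      using that f e fn_T pobjD(6)[OF P] by (intro cls_eqI[OF P Tp]) auto
    then show ?thesis using cls_hom[OF P Tp f] by (auto simp: hom_PE)
  qed
  then have "is_terminal PE ?T" using Tp unfolding is_terminal_def Obj_PE by blast
  then show ?thesis ..
qed

text \<open>
  The exponential is carried by the exponential of the underlying objects, which is again separated
  and injective; two of its points are related if, as functions, they send related arguments to
  related values. A representative of a transpose need not be a transpose of a representative on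
  the nose, but it is related to one, because it is compared only on related arguments.
\<close>

lemma ex_exponential_PE:
  assumes P: "P \<in> pobj" and Q: "Q \<in> pobj" and expo: "exponentiable X (fst P)"
    and preserves: "\<And>R. is_separated_reflector X le R \<Longrightarrow>
      preserves_finite_products X (separated_subcategory X le) R"
  shows "\<exists>E ev. is_exponential PE (\<lambda>Z. pprd Z P) (\<lambda>Z. ppr1 Z P) (\<lambda>Z. ppr2 Z P) Q E ev"
proof -
  define A where "A = fst P"
  define Y where "Y = fst Q"
  note A = pobjD(3)[OF P, folded A_def] and Y = pobjD(3)[OF Q, folded Y_def]
  obtain E ev where E: "evaluation A Y E ev"
    using ex_evaluation expo A_def Y by blast
  have EO: "E \<in> Obj X" and ev: "ev \<in> hom X (prd E A) Y"
    using evaluation_Obj[OF A E] evaluation_hom[OF A E] .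
  let ?p = "pr1 E A" and ?q = "pr2 E A"
  define per where "per = {(\<phi>, \<psi>). \<phi> \<in> el E \<and> \<psi> \<in> el E \<and>
    (\<forall>w\<in>el (prd E A). \<forall>w'\<in>el (prd E A). fn ?p w = \<phi> \<and> fn ?p w' = \<psi> \<and> (fn ?q w, fn ?q w') \<in> snd P
      \<longrightarrow> (fn ev w, fn ev w') \<in> snd Q)}"
  have sym_per: "sym per"
    unfolding sym_def per_def using per_refl(3)[OF P] per_refl(3)[OF Q] by blast
  have "trans per"
  proof (rule transI)
    fix \<phi> \<psi> \<chi> assume 1: "(\<phi>, \<psi>) \<in> per" and 2: "(\<psi>, \<chi>) \<in> per"
    have "(fn ev w, fn ev w') \<in> snd Q"
      if w: "w \<in> el (prd E A)" "w' \<in> el (prd E A)" "fn ?p w = \<phi>" "fn ?p w' = \<chi>"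
        "(fn ?q w, fn ?q w') \<in> snd P" for w w'
    proof -
      have "\<psi> \<in> el E" "fn ?q w' \<in> el A"
        using 1 pobjD(6)[OF P w(5)] by (auto simp: per_def A_def)
      then obtain v where v: "v \<in> el (prd E A)" "fn ?p v = \<psi>" "fn ?q v = fn ?q w'"
        using prd_el_ex[OF EO A] by blast
      have "(fn ev w, fn ev v) \<in> snd Q" using 1 w v unfolding per_def by simp
      moreover have "(fn ev v, fn ev w') \<in> snd Q"
        using 2 w v per_refl(2)[OF P w(5)] unfolding per_def by simp
      ultimately show ?thesis using pobjD(5)[OF Q] by (meson transD)
    qed
    then show "(\<phi>, \<chi>) \<in> per" using 1 2 unfolding per_def by simp
  qed
  moreover have "sep E"
    using sep_exponential[OF A E] pobjD(1)[OF P] pobjD(1)[OF Q] preserves by (simp add: A_def Y_def)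
  moreover have "inj_obj E"
    using inj_obj_exponential[OF A E] pobjD(1,2)[OF Q] by (simp add: Y_def)
  moreover have "per \<subseteq> el E \<times> el E" by (auto simp: per_def)
  ultimately have Ep: "(E, per) \<in> pobj" using sym_per by (simp add: PEqu_objects_def)
  let ?E = "(E, per)"
  note PEp = pprd_pobj[OF Ep P]
  have prd_iff: "(z, z') \<in> snd (pprd Z P) \<longleftrightarrow> z \<in> el (prd (fst Z) A) \<and> z' \<in> el (prd (fst Z) A) \<and>
      (fn (pr1 (fst Z) A) z, fn (pr1 (fst Z) A) z') \<in> snd Z \<and>
      (fn (pr2 (fst Z) A) z, fn (pr2 (fst Z) A) z') \<in> snd P" if "Z \<in> pobj" for Z z z'
    using pprd_iff[OF that P] by (simp add: A_def)
  have fst_prd: "fst (pprd Z P) = prd (fst Z) A" if "Z \<in> pobj" for Z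
    using fst_pprd[OF that P] by (simp add: A_def)
  have p1: "pr1 (fst Z) A \<in> eqv (pprd Z P) Z" and p2: "pr2 (fst Z) A \<in> eqv (pprd Z P) P"
    if "Z \<in> pobj" for Z
    using pr1_eqv[OF that P] pr2_eqv[OF that P] by (simp_all add: A_def)
  have eve: "ev \<in> eqv (pprd ?E P) Q"
  proof (rule eqvI)
    show "ev \<in> hom X (fst (pprd ?E P)) (fst Q)" using ev by (simp add: fst_prd[OF Ep] Y_def)
    fix z z' assume "(z, z') \<in> snd (pprd ?E P)"
    then have "z \<in> el (prd E A)" "z' \<in> el (prd E A)" "(fn ?p z, fn ?p z') \<in> per" "(fn ?q z, fn ?q z') \<in> snd P"
      by (simp_all add: prd_iff[OF Ep])
    then show "(fn ev z, fn ev z') \<in> snd Q" unfolding per_def by simp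
  qed
  have "is_exponential PE (\<lambda>Z. pprd Z P) (\<lambda>Z. ppr1 Z P) (\<lambda>Z. ppr2 Z P) Q ?E (cls (pprd ?E P) Q ev)"
    unfolding is_exponential_def
  proof (intro conjI ballI)
    show "?E \<in> Obj PE" using Ep by (simp add: Obj_PE)
    show "cls (pprd ?E P) Q ev \<in> hom PE (pprd ?E P) Q" using cls_hom[OF PEp Q eve] .
    fix Z H
    assume "H \<in> hom PE (pprd Z P) Q" and "Z \<in> Obj PE"
    then obtain h where Z: "Z \<in> pobj" and h: "h \<in> eqv (pprd Z P) Q" "H = cls (pprd Z P) Q h"
      by (auto elim: hom_PE_cls simp: Obj_PE)
    note ZO = pobjD(3)[OF Z] and ZP = pprd_pobj[OF Z P]
    let ?p' = "pr1 (fst Z) A" and ?q' = "pr2 (fst Z) A"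
    note p' = pr1_hom[OF ZO A] and q' = pr2_hom[OF ZO A] and p = pr1_hom[OF EO A] and q = pr2_hom[OF EO A]
    have hh: "h \<in> hom X (prd (fst Z) A) Y" using eqvD(1)[OF h(1)] by (simp add: fst_prd[OF Z] Y_def)
    obtain k m where k: "k \<in> hom X (fst Z) E" and m: "m \<in> hom X (prd (fst Z) A) (prd E A)"
      and km: "?p \<cdot> m = k \<cdot> ?p'" "?q \<cdot> m = ?q'" "ev \<cdot> m = h"
      using ex_transpose[OF A E ZO hh] .
    have pm: "fn ?p (fn m v) = fn k (fn ?p' v)" and qm: "fn ?q (fn m v) = fn ?q' v"
      and em: "fn ev (fn m v) = fn h v" if "v \<in> el (prd (fst Z) A)" for v
      using Comp_eqD[OF km(1) m p that] Comp_eqD[OF km(2) m q that] Comp_eqD[OF km(3) m ev that]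
        fn_Comp[OF p' k that] by auto
    have lift: "\<exists>v\<in>el (prd (fst Z) A). fn ?p' v = z \<and> fn ?q' v = fn ?q w"
      if "z \<in> el (fst Z)" "w \<in> el (prd E A)" for z w
      using prd_el_ex[OF ZO A that(1) fn_in[OF q that(2)]] by blast
    have m_eqI: "w = fn m v" if "v \<in> el (prd (fst Z) A)" "w \<in> el (prd E A)"
      "fn ?p w = fn k (fn ?p' v)" "fn ?q w = fn ?q' v" for v w
      using prd_el_eqI[OF EO A that(2) fn_in[OF m that(1)]] pm[OF that(1)] qm[OF that(1)] that(3,4) by simp
    \<comment> \<open>The arguments of \<open>w\<close> and \<open>w'\<close> lift to points \<open>v\<close> and \<open>v'\<close> of \<open>Z \<times> A\<close> over \<open>z\<close> and \<open>z'\<close>. Then \<open>w'\<close>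
      is the image of \<open>v'\<close> under \<open>k \<times> A\<close>, so its value is \<open>h v'\<close>, and only \<open>w\<close> remains to be compared.\<close>
    have to_k: "(fn l z, fn k z') \<in> per"
      if l: "l \<in> hom X (fst Z) E" and z: "(z, z') \<in> snd Z"
        and val: "\<And>v v' w. \<lbrakk>(v, v') \<in> snd (pprd Z P); fn ?p' v = z; w \<in> el (prd E A);
          fn ?p w = fn l (fn ?p' v); fn ?q w = fn ?q' v\<rbrakk> \<Longrightarrow> (fn ev w, fn h v') \<in> snd Q"
      for l z z'
    proof -
      have zel: "z \<in> el (fst Z)" "z' \<in> el (fst Z)" using pobjD(6)[OF Z z] by auto
      have "(fn ev w, fn ev w') \<in> snd Q"
        if w: "w \<in> el (prd E A)" "w' \<in> el (prd E A)" "fn ?p w = fn l z" "fn ?p w' = fn k z'"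
          "(fn ?q w, fn ?q w') \<in> snd P" for w w'
      proof -
        obtain v where v: "v \<in> el (prd (fst Z) A)" "fn ?p' v = z" "fn ?q' v = fn ?q w"
          using lift[OF zel(1) w(1)] by blast
        obtain v' where v': "v' \<in> el (prd (fst Z) A)" "fn ?p' v' = z'" "fn ?q' v' = fn ?q w'"
          using lift[OF zel(2) w(2)] by blast
        have "w' = fn m v'" using m_eqI[OF v'(1) w(2)] w(4) v'(2,3) by simp
        moreover have "(fn ev w, fn h v') \<in> snd Q"
          using v v' w z by (intro val[of v v' w]) (auto simp: prd_iff[OF Z])
        ultimately show ?thesis using em[OF v'(1)] by simp
      qed
      then show ?thesis unfolding per_def using fn_in[OF l zel(1)] fn_in[OF k zel(2)] by simp
    qed
    have ke: "k \<in> eqv Z ?E"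
    proof (rule eqvI)
      show "k \<in> hom X (fst Z) (fst ?E)" using k by simp
      fix z z' assume z: "(z, z') \<in> snd Z"
      have "(fn k z, fn k z') \<in> per"
      proof (rule to_k[OF k z])
        fix v v' w
        assume v: "(v, v') \<in> snd (pprd Z P)" and w: "w \<in> el (prd E A)"
          "fn ?p w = fn k (fn ?p' v)" "fn ?q w = fn ?q' v"
        have "v \<in> el (prd (fst Z) A)" using v by (simp add: prd_iff[OF Z])
        then show "(fn ev w, fn h v') \<in> snd Q"
          using m_eqI[OF _ w] em eqvD(2)[OF h(1) v] by simp
      qed
      then show "(fn k z, fn k z') \<in> snd ?E" by simp
    qed
    have me: "m \<in> eqv (pprd Z P) (pprd ?E P)"
    proof (rule eqvI)
      show "m \<in> hom X (fst (pprd Z P)) (fst (pprd ?E P))"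
        using m by (simp add: fst_prd[OF Z] fst_prd[OF Ep])
      fix v v' assume "(v, v') \<in> snd (pprd Z P)"
      then show "(fn m v, fn m v') \<in> snd (pprd ?E P)"
        using pm qm fn_in[OF m] eqvD(2)[OF ke] by (simp add: prd_iff[OF Z] prd_iff[OF Ep])
    qed
    have pprs: "ppr1 ?E P = cls (pprd ?E P) ?E ?p" "ppr2 ?E P = cls (pprd ?E P) P ?q"
      "ppr1 Z P = cls (pprd Z P) Z ?p'" "ppr2 Z P = cls (pprd Z P) P ?q'"
      unfolding ppr1_def ppr2_def by (simp_all add: A_def)
    have pe: "?p \<in> eqv (pprd ?E P) ?E" "?q \<in> eqv (pprd ?E P) P"
      using p1[OF Ep] p2[OF Ep] by simp_all
    show "\<exists>!K. K \<in> hom PE Z ?E \<and> (\<exists>M\<in>hom PE (pprd Z P) (pprd ?E P).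
        ppr1 ?E P \<cdot>\<^bsub>PE\<^esub> M = K \<cdot>\<^bsub>PE\<^esub> ppr1 Z P \<and> ppr2 ?E P \<cdot>\<^bsub>PE\<^esub> M = ppr2 Z P \<and>
        cls (pprd ?E P) Q ev \<cdot>\<^bsub>PE\<^esub> M = H)"
    proof (rule ex1I)
      show "cls Z ?E k \<in> hom PE Z ?E \<and> (\<exists>M\<in>hom PE (pprd Z P) (pprd ?E P).
        ppr1 ?E P \<cdot>\<^bsub>PE\<^esub> M = cls Z ?E k \<cdot>\<^bsub>PE\<^esub> ppr1 Z P \<and> ppr2 ?E P \<cdot>\<^bsub>PE\<^esub> M = ppr2 Z P \<and>
        cls (pprd ?E P) Q ev \<cdot>\<^bsub>PE\<^esub> M = H)"
      proof (intro conjI bexI[of _ "cls (pprd Z P) (pprd ?E P) m"])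
        show "cls Z ?E k \<in> hom PE Z ?E" using cls_hom[OF Z Ep ke] .
        show "cls (pprd Z P) (pprd ?E P) m \<in> hom PE (pprd Z P) (pprd ?E P)"
          using cls_hom[OF ZP PEp me] .
      qed (simp_all add: pprs cls_Comp Z P Q Ep PEp ZP ke me pe p1 p2 eve km h(2))
    next
      fix K
      assume K: "K \<in> hom PE Z ?E \<and> (\<exists>M\<in>hom PE (pprd Z P) (pprd ?E P).
        ppr1 ?E P \<cdot>\<^bsub>PE\<^esub> M = K \<cdot>\<^bsub>PE\<^esub> ppr1 Z P \<and> ppr2 ?E P \<cdot>\<^bsub>PE\<^esub> M = ppr2 Z P \<and>
        cls (pprd ?E P) Q ev \<cdot>\<^bsub>PE\<^esub> M = H)"
      then obtain l where l: "l \<in> eqv Z ?E" "K = cls Z ?E l" by (auto elim: hom_PE_cls)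
      from K obtain n where n: "n \<in> eqv (pprd Z P) (pprd ?E P)"
        and "ppr1 ?E P \<cdot>\<^bsub>PE\<^esub> cls (pprd Z P) (pprd ?E P) n = K \<cdot>\<^bsub>PE\<^esub> ppr1 Z P"
          "ppr2 ?E P \<cdot>\<^bsub>PE\<^esub> cls (pprd Z P) (pprd ?E P) n = ppr2 Z P"
          "cls (pprd ?E P) Q ev \<cdot>\<^bsub>PE\<^esub> cls (pprd Z P) (pprd ?E P) n = H"
        by (auto elim: hom_PE_cls)
      then have eqs: "cls (pprd Z P) ?E (?p \<cdot> n) = cls (pprd Z P) ?E (l \<cdot> ?p')"
        "cls (pprd Z P) P (?q \<cdot> n) = cls (pprd Z P) P ?q'"
        "cls (pprd Z P) Q (ev \<cdot> n) = cls (pprd Z P) Q h"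
        by (simp_all add: pprs l cls_Comp Z P Q Ep PEp ZP pe p1 p2 eve h(2))
      have nh: "n \<in> hom X (prd (fst Z) A) (prd E A)"
        using eqvD(1)[OF n] by (simp add: fst_prd[OF Z] fst_prd[OF Ep])
      have lh: "l \<in> hom X (fst Z) E" using eqvD(1)[OF l(1)] by simp
      have n1: "(fn ?p (fn n v), fn l (fn ?p' v')) \<in> per"
        and n2: "(fn ?q (fn n v), fn ?q' v') \<in> snd P"
        and n3: "(fn ev (fn n v), fn h v') \<in> snd Q" if v: "(v, v') \<in> snd (pprd Z P)" for v v'
      proof -
        have vel: "v \<in> el (prd (fst Z) A)" "v' \<in> el (prd (fst Z) A)" using v by (simp_all add: prd_iff[OF Z])
        show "(fn ?p (fn n v), fn l (fn ?p' v')) \<in> per"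
          using cls_eqD[OF eqs(1) ZP Ep eqv_Comp[OF ZP n pe(1)] eqv_Comp[OF ZP p1[OF Z] l(1)] v]
            fn_Comp[OF nh p vel(1)] fn_Comp[OF p' lh vel(2)] by simp
        show "(fn ?q (fn n v), fn ?q' v') \<in> snd P"
          using cls_eqD[OF eqs(2) ZP P eqv_Comp[OF ZP n pe(2)] p2[OF Z] v] fn_Comp[OF nh q vel(1)] by simp
        show "(fn ev (fn n v), fn h v') \<in> snd Q"
          using cls_eqD[OF eqs(3) ZP Q eqv_Comp[OF ZP n eve] h(1) v] fn_Comp[OF nh ev vel(1)] by simp
      qed
      have "cls Z ?E l = cls Z ?E k"
      proof (rule cls_eqI[OF Z Ep l(1) ke])
        fix z z' assume z: "(z, z') \<in> snd Z"
        have "(fn l z, fn k z') \<in> per"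
        proof (rule to_k[OF lh z])
          fix v v' w
          assume v: "(v, v') \<in> snd (pprd Z P)" and "fn ?p' v = z" and w: "w \<in> el (prd E A)"
            "fn ?p w = fn l (fn ?p' v)" "fn ?q w = fn ?q' v"
          have vv: "(v, v) \<in> snd (pprd Z P)" using per_refl(1)[OF ZP v] .
          have "(fn n v, w) \<in> snd (pprd ?E P)"
            using n1[OF vv] n2[OF vv] w fn_in[OF nh] vv by (simp add: prd_iff[OF Ep] prd_iff[OF Z])
          then have "(fn ev w, fn ev (fn n v)) \<in> snd Q"
            using eqvD(2)[OF eve per_refl(3)[OF PEp]] by blast
          then show "(fn ev w, fn h v') \<in> snd Q"
            using n3[OF v] pobjD(5)[OF Q] by (meson transD)
        qed
        then show "(fn l z, fn k z') \<in> snd ?E" by simp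
      qed
      then show "K = cls Z ?E k" using l(2) by simp
    qed
  qed
  then show ?thesis by blast
qed

end

theorem theorem1p3:
  fixes small :: "'u set \<Rightarrow> bool"
    and X :: "('o, 'm) category"
    and U :: "('o, 'm, 'u) set_functor"
    and L :: "('u set, ('u set, 'u \<Rightarrow> 'u) arrow, 'o, 'm) functor_data"
    and pt :: 'u
    and le :: "'m \<Rightarrow> 'm \<Rightarrow> bool"
  assumes "set_universe small"
    and "category X"
    and "topological X (Sets small) U"
    and "left_adjoint (Sets small) X L U"
    and a: "preorder_enriched X le"
    and b: "\<And>A B x x' f. \<lbrakk>A \<in> Obj X; B \<in> Obj X;
              x \<in> hom X (omap L {pt}) A; x' \<in> hom X (omap L {pt}) A;
              initial_morphism X (Sets small) U A B f;
              simeq le (f \<cdot>\<^bsub>X\<^esub> x) (f \<cdot>\<^bsub>X\<^esub> x')\<rbrakk> \<Longrightarrow> simeq le x x'"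
    and c: "enough_injectives X (Sets small) U le"
    and d: "\<And>A. injective_object X (Sets small) U le A \<Longrightarrow> exponentiable X A"
    and e: "\<And>R. is_separated_reflector X le R \<Longrightarrow>
              preserves_finite_products X (separated_subcategory X le) R"
  shows "cartesian_closed (PEqu_sep small X U le)"
proof -
  interpret ordered_topological small X U le
    using assms(1-3) a
    by (simp add: ordered_topological_def ordered_topological_axioms_def topological_over_sets_def
        topological_over_sets_axioms_def)
  have "exponentiable PE P" if P: "P \<in> pobj" for P
  proof -
    interpret PE: products_with PE P "\<lambda>Z. pprd Z P" "\<lambda>Z. ppr1 Z P" "\<lambda>Z. ppr2 Z P"
      by (intro products_with.intro category_PE products_with_axioms.intro)
        (simp add: Obj_PE pprd_product P)
    show ?thesis
    proof (rule PE.exponentiableI)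
      fix Q assume "Q \<in> Obj PE"
      then show "\<exists>E ev. is_exponential PE (\<lambda>Z. pprd Z P) (\<lambda>Z. ppr1 Z P) (\<lambda>Z. ppr2 Z P) Q E ev"
        using ex_exponential_PE[OF P _ d[OF pobjD(2)[OF P]] e] by (simp add: Obj_PE)
    qed (simp add: Obj_PE P)
  qed
  moreover have "has_finite_products PE"
    unfolding has_finite_products_def Obj_PE using ex_terminal_PE pprd_product by blast
  ultimately show ?thesis
    unfolding cartesian_closed_def Obj_PE using category_PE by blast
qed

end
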